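(* Let $\ell\ge3$. Let $\mu$ be an $\ell$-core with $\mu_1-\mu_2<\ell-1$ and $\mu'_1-\mu'_2<\ell-1$, let $r,s\ge0$ be integers, and let $\rho,\sigma$ be partitions with $\mathrm{len}(\rho)\le r+1$ and $\mathrm{len}(\sigma)\le s+1$, where if $\mu=\emptyset$ at least one of $\rho_{r+1},\sigma_{s+1}$ is zero. Then the partition $\lambda\approx(\mu,r,s,\rho,\sigma)$ is an $(\ell,0)$-JM partition. Conversely, every $(\ell,0)$-JM partition is of the form $\lambda\approx(\mu,r,s,\rho,\sigma)$ for some such data.
   Context: Young diagrams in English notation; $(a,b)$ is the box in row $a$, column $b$; $\lambda'$ is the conjugate partition, $\mathrm{len}$ the number of nonzero parts, and parts beyond the length are $0$. The hook length $h^\lambda_{(a,b)}$ is the number of boxes of $\lambda$ in row $a$ weakly right of $(a,b)$ plus those in column $b$ strictly below it. An $\ell$-core is a partition with no hook length divisible by $\ell$. A partition $\lambda$ is an $(\ell,0)$-JM partition if there do not exist boxes $(a,b),(a,y),(x,b)$ of $\lambda$ with $\ell\mid h^\lambda_{(a,b)}$, $\ell\nmid h^\lambda_{(a,y)}$, $\ell\nmid h^\lambda_{(x,b)}$. Construction of $\lambda\approx(\mu,r,s,\rho,\sigma)$: first form the $\ell$-core $(\mu,r,s,\emptyset,\emptyset)$ by placing the diagram of $\mu$ with its top-left corner at position $(r+1,s+1)$, attaching $r$ rows above it, row $i$ ($1\le i\le r$) of length $s+\mu_1+(r+1-i)(\ell-1)$ (so each row is $\ell-1$ boxes longer than the one below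 it), and attaching $s$ columns to its left, column $j$ ($1\le j\le s$) of length $r+\mu'_1+(s+1-j)(\ell-1)$ (each column $\ell-1$ boxes longer than the one to its right). Then, for $1\le i\le r+1$, attach $\rho_i$ horizontal $\ell$-rim hooks to row $i$ (add $\rho_i\ell$ boxes at the end of row $i$), and for $1\le j\le s+1$ attach $\sigma_j$ vertical $\ell$-rim hooks to column $j$ (add $\sigma_j\ell$ boxes at the bottom of column $j$). The resulting partition is denoted $\lambda\approx(\mu,r,s,\rho,\sigma)$. *)

theory Defs
  imports Main
begin

text \<open>A partition is the list of its nonzero parts in weakly decreasing order, so that
  \<^term>\<open>length\<close> is the number of nonzero parts and \<^term>\<open>[]\<close> is the empty partition.\<close>

definition is_partition :: "nat list \<Rightarrow> bool" where
  "is_partition p \<longleftrightarrow> sorted_wrt (\<ge>) p \<and> 0 \<notin> set p"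

text \<open>Parts, rows and columns are numbered from 1.\<close>

definition part :: "nat list \<Rightarrow> nat \<Rightarrow> nat" where
  "part p i = (if 1 \<le> i \<and> i \<le> length p then p ! (i - 1) else 0)"

definition diagram :: "nat list \<Rightarrow> (nat \<times> nat) set" where
  "diagram p = {(a, b). 1 \<le> a \<and> 1 \<le> b \<and> b \<le> part p a}"

definition row_len :: "(nat \<times> nat) set \<Rightarrow> nat \<Rightarrow> nat" where
  "row_len D i = card {b. (i, b) \<in> D}"

definition col_len :: "(nat \<times> nat) set \<Rightarrow> nat \<Rightarrow> nat" where
  "col_len D j = card {a. (a, j) \<in> D}"

definition conjugate :: "nat list \<Rightarrow> nat list" where
  "conjugate p = map (col_len (diagram p)) [1..<part p 1 + 1]"

definition hook_length :: "nat list \<Rightarrow> nat \<times> nat \<Rightarrow> nat" where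
  "hook_length p = (\<lambda>(a, b).
     card {y. (a, y) \<in> diagram p \<and> b \<le> y} + card {x. (x, b) \<in> diagram p \<and> a < x})"

definition is_core :: "nat \<Rightarrow> nat list \<Rightarrow> bool" where
  "is_core l p \<longleftrightarrow> is_partition p \<and> (\<forall>c \<in> diagram p. \<not> l dvd hook_length p c)"

definition is_JM :: "nat \<Rightarrow> nat list \<Rightarrow> bool" where
  "is_JM l p \<longleftrightarrow> is_partition p \<and>
     \<not> (\<exists>a b x y. (a, b) \<in> diagram p \<and> (a, y) \<in> diagram p \<and> (x, b) \<in> diagram p \<and>
          l dvd hook_length p (a, b) \<and>
          \<not> l dvd hook_length p (a, y) \<and> \<not> l dvd hook_length p (x, b))"

text \<open>The diagram of the core $(\mu, r, s, \emptyset, \emptyset)$. The subtractions do not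
  truncate, since $i \le r$, $j \le s$ and $l \ge 1$. The prescribed row and column lengths are
  total lengths, so the first \<open>s\<close> boxes of the attached rows and the first \<open>r\<close> boxes of the
  attached columns overlap in the $r \times s$ corner.\<close>

definition core_diagram ::
    "nat \<Rightarrow> nat list \<Rightarrow> nat \<Rightarrow> nat \<Rightarrow> (nat \<times> nat) set" where
  "core_diagram l \<mu> r s =
     {(r + a, s + b) | a b. (a, b) \<in> diagram \<mu>}
   \<union> {(i, b). 1 \<le> i \<and> i \<le> r \<and> 1 \<le> b \<and> b \<le> s + part \<mu> 1 + (r + 1 - i) * (l - 1)}
   \<union> {(a, j). 1 \<le> j \<and> j \<le> s \<and> 1 \<le> a \<and>
        a \<le> r + part (conjugate \<mu>) 1 + (s + 1 - j) * (l - 1)}"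

text \<open>Both kinds of rim hooks are attached to the rows and columns of the core diagram.\<close>

definition built_diagram ::
    "nat \<Rightarrow> nat list \<Rightarrow> nat \<Rightarrow> nat \<Rightarrow> nat list \<Rightarrow> nat list \<Rightarrow> (nat \<times> nat) set" where
  "built_diagram l \<mu> r s \<rho> \<sigma> =
     (let C = core_diagram l \<mu> r s in
        C
      \<union> {(i, b). 1 \<le> i \<and> i \<le> r + 1 \<and> row_len C i < b \<and> b \<le> row_len C i + part \<rho> i * l}
      \<union> {(a, j). 1 \<le> j \<and> j \<le> s + 1 \<and> col_len C j < a \<and> a \<le> col_len C j + part \<sigma> j * l})"

text \<open>$\lambda \approx (\mu, r, s, \rho, \sigma)$\<close>

definition has_form ::
    "nat \<Rightarrow> nat list \<Rightarrow> nat list \<Rightarrow> nat \<Rightarrow> nat \<Rightarrow> nat list \<Rightarrow> nat list \<Rightarrow> bool" where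
  "has_form l p \<mu> r s \<rho> \<sigma> \<longleftrightarrow>
     is_partition p \<and> diagram p = built_diagram l \<mu> r s \<rho> \<sigma>"

definition admissible ::
    "nat \<Rightarrow> nat list \<Rightarrow> nat \<Rightarrow> nat \<Rightarrow> nat list \<Rightarrow> nat list \<Rightarrow> bool" where
  "admissible l \<mu> r s \<rho> \<sigma> \<longleftrightarrow>
     is_core l \<mu> \<and>
     part \<mu> 1 - part \<mu> 2 < l - 1 \<and>
     part (conjugate \<mu>) 1 - part (conjugate \<mu>) 2 < l - 1 \<and>
     is_partition \<rho> \<and> is_partition \<sigma> \<and>
     length \<rho> \<le> r + 1 \<and> length \<sigma> \<le> s + 1 \<and>
     (\<mu> = [] \<longrightarrow> part \<rho> (r + 1) = 0 \<or> part \<sigma> (s + 1) = 0)"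

end

theory Submission
  imports Defs
begin

text \<open>Let \<open>f a\<close> and \<open>g b\<close> be the row and column lengths. The hook length at \<open>(a, b)\<close> is
  \<open>(f a - a) + (g b - b) + 1\<close>, so each row and each column has a colour modulo \<open>l\<close>, and \<open>l\<close> divides
  the hook length iff the colours of row \<open>a\<close> and column \<open>b\<close> match. Consecutive rows have the same
  colour iff their lengths differ by \<open>-1\<close> modulo \<open>l\<close>.

  In a constructed partition the rows \<open>1, \<dots>, r + 1\<close> share one colour, as do the columns
  \<open>1, \<dots>, s + 1\<close>. A box to the right of \<open>\<mu>\<close> lies in a column that only meets the first \<open>r + 1\<close>
  rows, so the hook lengths in its column are congruent; symmetrically for boxes below \<open>\<mu>\<close>; every other
  box has a hook length congruent to one of \<open>\<mu>\<close>, or to \<open>-1\<close> if \<open>\<mu>\<close> is empty.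

  Conversely, take \<open>r\<close> and \<open>s\<close> maximal such that the first \<open>r + 1\<close> rows and the first \<open>s + 1\<close>
  columns share a colour, and strip as many rim hooks as possible from row \<open>r + 1\<close> and column
  \<open>s + 1\<close>. A divisible hook length in the remaining \<open>\<mu>\<close> would, by the JM condition, make a whole
  row or column of the partition divisible, which maximality of \<open>r\<close> and \<open>s\<close> forbids.\<close>

section \<open>Row and column lengths\<close>

text \<open>\<open>f\<close> and \<open>g\<close> are the row and column lengths of one Young
  diagram. The relation is symmetric, so conjugation merely swaps them; values at 0 are left
  free.\<close>

definition conj_funs :: "(nat \<Rightarrow> nat) \<Rightarrow> (nat \<Rightarrow> nat) \<Rightarrow> bool" where
  "conj_funs f g \<longleftrightarrow> (\<forall>a\<ge>1. \<forall>b\<ge>1. b \<le> f a \<longleftrightarrow> a \<le> g b)"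

lemma conj_funsD: "conj_funs f g \<Longrightarrow> 1 \<le> a \<Longrightarrow> 1 \<le> b \<Longrightarrow> b \<le> f a \<longleftrightarrow> a \<le> g b"
  by (simp add: conj_funs_def)

lemma conj_funs_sym: "conj_funs f g \<Longrightarrow> conj_funs g f"
  by (simp add: conj_funs_def)

lemma conj_funs_antimono:
  assumes "conj_funs f g" "1 \<le> a" "a \<le> a'"
  shows "f a' \<le> f a"
proof (cases "f a' = 0")
  case False
  then have "a' \<le> g (f a')"
    using conj_funsD[OF assms(1), of a' "f a'"] assms by simp
  then show ?thesis
    using conj_funsD[OF assms(1), of a "f a'"] assms False by simp
qed simp

lemma eq_of_le_iff:
  fixes x y :: nat
  assumes "\<And>b. 1 \<le> b \<Longrightarrow> b \<le> x \<longleftrightarrow> b \<le> y"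
  shows "x = y"
  using assms[of x] assms[of y] by (cases "x = 0"; cases "y = 0") auto

lemma conj_funs_unique:
  assumes "conj_funs f g" "conj_funs f' g'" "\<And>a. 1 \<le> a \<Longrightarrow> f a = f' a" "1 \<le> b"
  shows "g b = g' b"
proof (rule eq_of_le_iff)
  show "a \<le> g b \<longleftrightarrow> a \<le> g' b" if "1 \<le> a" for a
    using conj_funsD[OF assms(1) that assms(4)] conj_funsD[OF assms(2) that assms(4)] assms(3)[OF that]
    by simp
qed

lemma initial_segment:
  fixes X :: "nat set"
  assumes "finite X" "0 \<notin> X" "\<And>x y. x \<in> X \<Longrightarrow> 1 \<le> y \<Longrightarrow> y \<le> x \<Longrightarrow> y \<in> X"
  shows "X = {1..card X}"
proof (cases "X = {}")
  case False
  have "X = {1..Max X}"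
  proof (intro equalityI subsetI)
    fix x assume "x \<in> X"
    then show "x \<in> {1..Max X}" using assms(1,2) by (cases x) auto
  next
    fix x assume "x \<in> {1..Max X}"
    then show "x \<in> X" using assms(3)[OF Max_in[OF assms(1) False], of x] by simp
  qed
  then show ?thesis by (metis card_atLeastAtMost diff_Suc_1)
qed simp

text \<open>Each row and column of a finite set closed upwards and to the left is an initial
  segment, so its cardinality decides membership.\<close>

lemma young_set:
  assumes "finite D" "\<And>a b. (a, b) \<in> D \<Longrightarrow> 1 \<le> a \<and> 1 \<le> b"
    and "\<And>a b a' b'. (a, b) \<in> D \<Longrightarrow> 1 \<le> a' \<Longrightarrow> a' \<le> a \<Longrightarrow> 1 \<le> b' \<Longrightarrow> b' \<le> b \<Longrightarrow> (a', b') \<in> D"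
  shows "1 \<le> a \<Longrightarrow> 1 \<le> b \<Longrightarrow> (a, b) \<in> D \<longleftrightarrow> b \<le> row_len D a"
    and "1 \<le> a \<Longrightarrow> 1 \<le> b \<Longrightarrow> (a, b) \<in> D \<longleftrightarrow> a \<le> col_len D b"
    and "conj_funs (row_len D) (col_len D)"
proof -
  have row: "{b. (a, b) \<in> D} = {1..row_len D a}" for a
    unfolding row_len_def
  proof (rule initial_segment)
    have "{b. (a, b) \<in> D} \<subseteq> snd ` D" by force
    then show "finite {b. (a, b) \<in> D}" using assms(1) finite_subset by blast
    show "0 \<notin> {b. (a, b) \<in> D}" using assms(2) by force
    show "y \<in> {b. (a, b) \<in> D}" if "x \<in> {b. (a, b) \<in> D}" "1 \<le> y" "y \<le> x" for x y
      using assms(3)[of a x a y] assms(2)[of a x] that by simp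
  qed
  have col: "{a. (a, b) \<in> D} = {1..col_len D b}" for b
    unfolding col_len_def
  proof (rule initial_segment)
    have "{a. (a, b) \<in> D} \<subseteq> fst ` D" by force
    then show "finite {a. (a, b) \<in> D}" using assms(1) finite_subset by blast
    show "0 \<notin> {a. (a, b) \<in> D}" using assms(2) by force
    show "y \<in> {a. (a, b) \<in> D}" if "x \<in> {a. (a, b) \<in> D}" "1 \<le> y" "y \<le> x" for x y
      using assms(3)[of x b y b] assms(2)[of x b] that by simp
  qed
  show r: "(a, b) \<in> D \<longleftrightarrow> b \<le> row_len D a" if "1 \<le> a" "1 \<le> b" for a b
    using row[of a] that by (auto simp: set_eq_iff)
  show c: "(a, b) \<in> D \<longleftrightarrow> a \<le> col_len D b" if "1 \<le> a" "1 \<le> b" for a b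
    using col[of b] that by (auto simp: set_eq_iff)
  show "conj_funs (row_len D) (col_len D)"
    unfolding conj_funs_def using r c by blast
qed

section \<open>Partitions as lists and as functions\<close>

lemma part_antimono:
  assumes "is_partition p" "1 \<le> a" "a \<le> a'"
  shows "part p a' \<le> part p a"
proof (cases "a' \<le> length p \<and> a < a'")
  case True
  then have "a - 1 < a' - 1" "a' - 1 < length p" using assms(2) by linarith+
  then have "p ! (a' - 1) \<le> p ! (a - 1)"
    using assms sorted_wrt_nth_less[of "(\<ge>)" p "a - 1" "a' - 1"]
    by (simp add: is_partition_def)
  then show ?thesis using assms True by (simp add: part_def)
next
  case False
  then show ?thesis using assms by (auto simp: part_def)
qed

lemma finite_diagram: "finite (diagram p)"
proof (rule finite_subset)
  show "diagram p \<subseteq> (SIGMA a:{1..length p}. {1..part p a})"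
    by (auto simp: diagram_def part_def split: if_splits)
qed simp

lemma conj_funs_part:
  assumes "is_partition p"
  shows "conj_funs (part p) (col_len (diagram p))"
proof -
  note ys = young_set[OF finite_diagram[of p]]
  have "(a, b) \<in> diagram p \<longleftrightarrow> a \<le> col_len (diagram p) b" if "1 \<le> a" "1 \<le> b" for a b
  proof (rule ys(2)[OF _ _ that])
    show "1 \<le> a \<and> 1 \<le> b" if "(a, b) \<in> diagram p" for a b
      using that by (simp add: diagram_def)
    show "(a', b') \<in> diagram p"
      if "(a, b) \<in> diagram p" "1 \<le> a'" "a' \<le> a" "1 \<le> b'" "b' \<le> b" for a b a' b'
      using that part_antimono[OF assms, of a' a] by (simp add: diagram_def)
  qed
  then show ?thesis by (simp add: conj_funs_def diagram_def)
qed

lemma part_conjugate: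
  assumes "is_partition p" "1 \<le> b"
  shows "part (conjugate p) b = col_len (diagram p) b"
proof (cases "b \<le> part p 1")
  case True
  then have "[1..<part p 1 + 1] ! (b - 1) = b" "b - 1 < length [1..<part p 1 + 1]"
    using assms(2) by (auto simp del: upt_Suc)
  then show ?thesis
    using assms(2) True unfolding part_def[of "conjugate p"] unfolding conjugate_def
    by (simp del: upt_Suc)
next
  case False
  then show ?thesis
    using assms(2) conj_funsD[OF conj_funs_part[OF assms(1)], of 1 b]
    unfolding part_def[of "conjugate p"] unfolding conjugate_def by (simp del: upt_Suc)
qed

text \<open>All listed parts are nonzero, so the length can be read off from where
  \<open>part\<close> is positive.\<close>

lemma part_inject:
  assumes "is_partition p" "is_partition q" "\<And>a. 1 \<le> a \<Longrightarrow> part p a = part q a"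
  shows "p = q"
proof -
  have pos: "0 < part p a \<longleftrightarrow> a \<le> length p" if "is_partition p" "1 \<le> a" for p a
  proof -
    have "p ! (a - 1) \<in> set p" if "a \<le> length p"
      using that \<open>1 \<le> a\<close> by (intro nth_mem) linarith
    then have "p ! (a - 1) \<noteq> 0" if "a \<le> length p"
      using that \<open>is_partition p\<close> by (metis is_partition_def)
    then show ?thesis using that by (auto simp: part_def)
  qed
  have iff: "a \<le> length p \<longleftrightarrow> a \<le> length q" if "1 \<le> a" for a
    using pos assms that by metis
  have len: "length p = length q"
    using iff[of "length p"] iff[of "length q"] by (cases p; cases q) auto
  show ?thesis
  proof (rule nth_equalityI[OF len])
    fix i assume "i < length p"
    then show "p ! i = q ! i" using assms(3)[of "Suc i"] len by (simp add: part_def)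
  qed
qed

lemma diagram_inject:
  assumes "is_partition p" "is_partition q" "diagram p = diagram q"
  shows "p = q"
proof (rule part_inject[OF assms(1,2)])
  fix a :: nat assume a: "1 \<le> a"
  have "b \<le> part p a \<longleftrightarrow> b \<le> part q a" if "1 \<le> b" for b
    using assms(3) a that by (auto simp: diagram_def set_eq_iff)
  then show "part p a = part q a" by (rule eq_of_le_iff)
qed

text \<open>Listing the values of \<open>h\<close> before its first zero leaves no zero part, and
  monotonicity makes all later values zero.\<close>

lemma partition_of_fun:
  assumes "\<And>a a'. 1 \<le> a \<Longrightarrow> a \<le> a' \<Longrightarrow> h a' \<le> h a" "\<And>a. n < a \<Longrightarrow> h a = (0::nat)"
  obtains p where "is_partition p" "length p \<le> n" "\<And>a. 1 \<le> a \<Longrightarrow> part p a = h a"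
proof -
  define c where "c = (LEAST k. h (k + 1) = 0)"
  have c0: "h (c + 1) = 0" unfolding c_def by (rule LeastI[of _ n]) (simp add: assms(2))
  have cn: "c \<le> n" unfolding c_def by (rule Least_le) (simp add: assms(2))
  have pos: "h (k + 1) \<noteq> 0" if "k < c" for k
    using not_less_Least[of k "\<lambda>k. h (k + 1) = 0"] that by (simp add: c_def)
  let ?p = "map (\<lambda>k. h (k + 1)) [0..<c]"
  have "is_partition ?p"
    unfolding is_partition_def using assms(1) pos by (force simp: sorted_wrt_iff_nth_less)
  moreover have "part ?p a = h a" if "1 \<le> a" for a
    using assms(1)[of "c + 1" a] c0 that by (cases "a \<le> c") (auto simp: part_def)
  ultimately show ?thesis using that[of ?p] cn by simp
qed

section \<open>Hook lengths\<close>

text \<open>Integer valued and defined at every position, also outside the diagram. It is a row term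
  plus a column term, so residues of rows and of columns can be handled separately.\<close>

definition hook :: "(nat \<Rightarrow> nat) \<Rightarrow> (nat \<Rightarrow> nat) \<Rightarrow> nat \<Rightarrow> nat \<Rightarrow> int" where
  "hook f g a b = int (f a) - int a + (int (g b) - int b) + 1"

lemma hook_swap: "hook g f b a = hook f g a b"
  by (simp add: hook_def)

lemma hook_length_eq:
  assumes "conj_funs (part p) g" "(a, b) \<in> diagram p"
  shows "int (hook_length p (a, b)) = hook (part p) g a b"
proof -
  have ab: "1 \<le> a" "1 \<le> b" "b \<le> part p a" using assms(2) by (auto simp: diagram_def)
  then have ga: "a \<le> g b" using conj_funsD[OF assms(1)] by blast
  have "{y. (a, y) \<in> diagram p \<and> b \<le> y} = {b..part p a}"
    using ab by (auto simp: diagram_def)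
  moreover have "{x. (x, b) \<in> diagram p \<and> a < x} = {a<..g b}"
    using ab conj_funsD[OF assms(1)] by (fastforce simp: diagram_def)
  ultimately show ?thesis using ab ga by (simp add: hook_length_def hook_def of_nat_diff)
qed

text \<open>The forbidden triple negated: a box with divisible hook length has its entire row or its
  entire column divisible.\<close>

definition jm_funs :: "nat \<Rightarrow> (nat \<Rightarrow> nat) \<Rightarrow> (nat \<Rightarrow> nat) \<Rightarrow> bool" where
  "jm_funs l f g \<longleftrightarrow> (\<forall>a b. 1 \<le> a \<longrightarrow> 1 \<le> b \<longrightarrow> b \<le> f a \<longrightarrow> int l dvd hook f g a b \<longrightarrow>
     (\<forall>y. 1 \<le> y \<and> y \<le> f a \<longrightarrow> int l dvd hook f g a y) \<or>
     (\<forall>x. 1 \<le> x \<and> x \<le> g b \<longrightarrow> int l dvd hook f g x b))"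

lemma jm_funs_swap:
  assumes "conj_funs f g"
  shows "jm_funs l g f \<longleftrightarrow> jm_funs l f g"
  using conj_funsD[OF assms] unfolding jm_funs_def hook_swap[of g f] by blast

lemma is_JM_iff:
  assumes "is_partition p" "conj_funs (part p) g"
  shows "is_JM l p \<longleftrightarrow> jm_funs l (part p) g"
proof -
  have dvd: "l dvd hook_length p (a, b) \<longleftrightarrow> int l dvd hook (part p) g a b"
    if "(a, b) \<in> diagram p" for a b
    using hook_length_eq[OF assms(2) that] by (metis of_nat_dvd_iff)
  have col: "(x, b) \<in> diagram p \<longleftrightarrow> 1 \<le> x \<and> 1 \<le> b \<and> x \<le> g b" for x b
    using conj_funsD[OF assms(2), of x b] by (auto simp: diagram_def)
  have row: "(a, y) \<in> diagram p \<longleftrightarrow> 1 \<le> a \<and> 1 \<le> y \<and> y \<le> part p a" for a y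
    by (auto simp: diagram_def)
  have "is_JM l p \<longleftrightarrow> (\<forall>a b. (a, b) \<in> diagram p \<longrightarrow> int l dvd hook (part p) g a b \<longrightarrow>
     (\<forall>y. (a, y) \<in> diagram p \<longrightarrow> int l dvd hook (part p) g a y) \<or>
     (\<forall>x. (x, b) \<in> diagram p \<longrightarrow> int l dvd hook (part p) g x b))"
    unfolding is_JM_def using assms(1) dvd by blast
  also have "\<dots> \<longleftrightarrow> jm_funs l (part p) g"
    unfolding jm_funs_def
  proof (intro iff_allI)
    fix a b
    show "((a, b) \<in> diagram p \<longrightarrow> int l dvd hook (part p) g a b \<longrightarrow>
        (\<forall>y. (a, y) \<in> diagram p \<longrightarrow> int l dvd hook (part p) g a y) \<or>
        (\<forall>x. (x, b) \<in> diagram p \<longrightarrow> int l dvd hook (part p) g x b)) \<longleftrightarrow>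
      (1 \<le> a \<longrightarrow> 1 \<le> b \<longrightarrow> b \<le> part p a \<longrightarrow> int l dvd hook (part p) g a b \<longrightarrow>
        (\<forall>y. 1 \<le> y \<and> y \<le> part p a \<longrightarrow> int l dvd hook (part p) g a y) \<or>
        (\<forall>x. 1 \<le> x \<and> x \<le> g b \<longrightarrow> int l dvd hook (part p) g x b))"
      using row[of a] col[of _ b] by blast
  qed
  finally show ?thesis .
qed

lemma is_core_iff:
  assumes "is_partition p" "conj_funs (part p) g"
  shows "is_core l p \<longleftrightarrow>
    (\<forall>a b. 1 \<le> a \<longrightarrow> 1 \<le> b \<longrightarrow> b \<le> part p a \<longrightarrow> \<not> int l dvd hook (part p) g a b)"
proof -
  have dvd: "l dvd hook_length p (a, b) \<longleftrightarrow> int l dvd hook (part p) g a b"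
    if "(a, b) \<in> diagram p" for a b
    using hook_length_eq[OF assms(2) that] by (metis of_nat_dvd_iff)
  have "is_core l p \<longleftrightarrow> (\<forall>a b. (a, b) \<in> diagram p \<longrightarrow> \<not> int l dvd hook (part p) g a b)"
    unfolding is_core_def using assms(1) dvd by auto
  then show ?thesis by (auto simp: diagram_def)
qed

section \<open>The shape of the construction\<close>

text \<open>Excess length of line \<open>i\<close> of the frame over the innermost line
  \<open>k + 1\<close>; truncated subtraction makes it 0 from there on.\<close>

definition stair :: "nat \<Rightarrow> nat \<Rightarrow> nat \<Rightarrow> nat" where
  "stair l k i = (k + 1 - i) * (l - 1)"

lemma stair_pos: "i \<le> k \<Longrightarrow> 2 \<le> l \<Longrightarrow> l - 1 \<le> stair l k i"
  by (simp add: stair_def Suc_diff_le)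

lemma stair_last [simp]: "stair l k (Suc k) = 0"
  by (simp add: stair_def)

lemma stair_antimono: "i \<le> i' \<Longrightarrow> stair l k i' \<le> stair l k i"
  unfolding stair_def by (rule mult_le_mono1) simp

text \<open>The built diagram as a predicate on boxes with positive coordinates. Row
  \<open>r + 1\<close> and column \<open>s + 1\<close> count as frame lines with staircase 0, so
  that one inequality covers a line together with its rim hooks.\<close>

definition shape ::
    "nat \<Rightarrow> (nat \<Rightarrow> nat) \<Rightarrow> (nat \<Rightarrow> nat) \<Rightarrow> nat \<Rightarrow> nat \<Rightarrow> (nat \<Rightarrow> nat) \<Rightarrow> (nat \<Rightarrow> nat) \<Rightarrow> nat \<Rightarrow> nat \<Rightarrow> bool" where
  "shape l m n r s P Q a b \<longleftrightarrow>
     r < a \<and> s < b \<and> b \<le> s + m (a - r) \<or>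
     a \<le> r + 1 \<and> b \<le> s + m 1 + stair l r a + P a * l \<or>
     b \<le> s + 1 \<and> a \<le> r + n 1 + stair l s b + Q b * l"

lemma shape_swap:
  assumes "conj_funs m n"
  shows "shape l n m s r Q P b a \<longleftrightarrow> shape l m n r s P Q a b"
proof -
  have "b \<le> s + m (a - r) \<longleftrightarrow> a \<le> r + n (b - s)" if "r < a" "s < b"
  proof -
    have "b \<le> s + m (a - r) \<longleftrightarrow> b - s \<le> m (a - r)" "a \<le> r + n (b - s) \<longleftrightarrow> a - r \<le> n (b - s)"
      using that by linarith+
    then show ?thesis using conj_funsD[OF assms, of "a - r" "b - s"] that by simp
  qed
  then show ?thesis unfolding shape_def by blast
qed

lemma core_diagram_iff:
  assumes "is_partition \<mu>" "2 \<le> l"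
  shows "(a, b) \<in> core_diagram l \<mu> r s \<longleftrightarrow>
    1 \<le> a \<and> 1 \<le> b \<and> shape l (part \<mu>) (col_len (diagram \<mu>)) r s (\<lambda>_. 0) (\<lambda>_. 0) a b"
proof -
  let ?n = "col_len (diagram \<mu>)"
  have mn: "conj_funs (part \<mu>) ?n" by (rule conj_funs_part[OF assms(1)])
  have inner: "(\<exists>a' b'. (a, b) = (r + a', s + b') \<and> (a', b') \<in> diagram \<mu>) \<longleftrightarrow>
      r < a \<and> s < b \<and> b \<le> s + part \<mu> (a - r)"
    (is "?L \<longleftrightarrow> ?R")
  proof
    assume ?R
    then show ?L
      by (intro exI[of _ "a - r"] exI[of _ "b - s"]) (auto simp: diagram_def)
  qed (auto simp: diagram_def)
  have eq: "(a, b) \<in> core_diagram l \<mu> r s \<longleftrightarrow>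
      r < a \<and> s < b \<and> b \<le> s + part \<mu> (a - r) \<or>
      1 \<le> a \<and> a \<le> r \<and> 1 \<le> b \<and> b \<le> s + part \<mu> 1 + stair l r a \<or>
      1 \<le> b \<and> b \<le> s \<and> 1 \<le> a \<and> a \<le> r + ?n 1 + stair l s b"
    unfolding core_diagram_def inner[symmetric] stair_def using part_conjugate[OF assms(1), of 1] by auto
  \<comment> \<open>Row \<open>r + 1\<close> adds nothing to the core: right of column
    \<open>s\<close> it is the first row of \<mu>, and the attached columns, which reach at least
    \<open>l - 1\<close> boxes below row \<open>r\<close>, cover the rest.\<close>
  have row: "r < a \<and> s < b \<and> b \<le> s + part \<mu> (a - r) \<or>
      b \<le> s \<and> a \<le> r + ?n 1 + stair l s b"
    if "a = r + 1" "b \<le> s + part \<mu> 1"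
    using that stair_pos[of b s l] assms(2) by (cases "s < b") auto
  have col: "r < a \<and> s < b \<and> b \<le> s + part \<mu> (a - r) \<or>
      a \<le> r \<and> b \<le> s + part \<mu> 1 + stair l r a"
    if "b = s + 1" "a \<le> r + ?n 1"
    using that stair_pos[of a r l] assms(2) conj_funsD[OF mn, of "a - r" 1] by (cases "r < a") auto
  show ?thesis
  proof (cases "1 \<le> a \<and> 1 \<le> b")
    case ab: True
    let ?A = "r < a \<and> s < b \<and> b \<le> s + part \<mu> (a - r)"
    let ?R = "b \<le> s + part \<mu> 1 + stair l r a" and ?C = "a \<le> r + ?n 1 + stair l s b"
    have "a \<le> r + 1 \<and> ?R \<longleftrightarrow> a \<le> r \<and> ?R \<or> a = r + 1 \<and> b \<le> s + part \<mu> 1"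
      by (cases "a = r + 1") auto
    moreover have "b \<le> s + 1 \<and> ?C \<longleftrightarrow> b \<le> s \<and> ?C \<or> b = s + 1 \<and> a \<le> r + ?n 1"
      by (cases "b = s + 1") auto
    ultimately show ?thesis
      unfolding eq shape_def mult_0 add_0_right using ab row col by blast
  next
    case False
    then show ?thesis unfolding eq by auto
  qed
qed

text \<open>The column part never sticks out of these rows. It reaches column \<open>s + 1\<close>
  at most, which a positive staircase covers if \<open>a \<le> r\<close>; in row
  \<open>r + 1\<close> it gets there only if \<mu> is nonempty, and then \<open>part \<mu> 1\<close>
  covers it.\<close>

lemma core_row_len:
  assumes "is_partition \<mu>" "2 \<le> l" "1 \<le> a" "a \<le> r + 1"
  shows "row_len (core_diagram l \<mu> r s) a = s + part \<mu> 1 + stair l r a"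
proof -
  let ?n = "col_len (diagram \<mu>)"
  have mn: "conj_funs (part \<mu>) ?n" by (rule conj_funs_part[OF assms(1)])
  have "b \<le> s + part \<mu> 1 + stair l r a"
    if "1 \<le> b" "shape l (part \<mu>) ?n r s (\<lambda>_. 0) (\<lambda>_. 0) a b" for b
  proof (cases "a = r + 1")
    case True
    then show ?thesis
      using that conj_funsD[OF mn, of 1 1] by (cases "b = s + 1") (auto simp: shape_def)
  next
    case False
    then have "1 \<le> stair l r a" using assms stair_pos[of a r l] by simp
    then show ?thesis using that False assms(4) unfolding shape_def by auto
  qed
  then have "{b. (a, b) \<in> core_diagram l \<mu> r s} = {1..s + part \<mu> 1 + stair l r a}"
    using assms by (auto simp: core_diagram_iff[OF assms(1,2)]) (auto simp: shape_def)
  then show ?thesis by (simp add: row_len_def)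
qed

lemma core_col_len:
  assumes "is_partition \<mu>" "2 \<le> l" "1 \<le> b" "b \<le> s + 1"
  shows "col_len (core_diagram l \<mu> r s) b = r + col_len (diagram \<mu>) 1 + stair l s b"
proof -
  let ?n = "col_len (diagram \<mu>)"
  have mn: "conj_funs (part \<mu>) ?n" by (rule conj_funs_part[OF assms(1)])
  have "a \<le> r + ?n 1 + stair l s b"
    if "1 \<le> a" "shape l (part \<mu>) ?n r s (\<lambda>_. 0) (\<lambda>_. 0) a b" for a
  proof (cases "b = s + 1")
    case True
    then show ?thesis
      using that conj_funsD[OF mn, of 1 1] conj_funsD[OF mn, of "a - r" 1]
      by (cases "a \<le> r"; cases "a = r + 1") (auto simp: shape_def)
  next
    case False
    then have "1 \<le> stair l s b" using assms stair_pos[of b s l] by simp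
    then show ?thesis using that False assms(4) unfolding shape_def by auto
  qed
  then have "{a. (a, b) \<in> core_diagram l \<mu> r s} = {1..r + ?n 1 + stair l s b}"
    using assms by (auto simp: core_diagram_iff[OF assms(1,2)]) (auto simp: shape_def)
  then show ?thesis by (simp add: col_len_def)
qed

lemma built_diagram_iff:
  assumes "is_partition \<mu>" "2 \<le> l"
  shows "(a, b) \<in> built_diagram l \<mu> r s \<rho> \<sigma> \<longleftrightarrow> 1 \<le> a \<and> 1 \<le> b \<and>
    shape l (part \<mu>) (col_len (diagram \<mu>)) r s (part \<rho>) (part \<sigma>) a b"
proof (cases "1 \<le> a \<and> 1 \<le> b")
  case True
  let ?X = "s + part \<mu> 1 + stair l r a" and ?Y = "r + col_len (diagram \<mu>) 1 + stair l s b"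
  have "a \<le> r + 1 \<and> row_len (core_diagram l \<mu> r s) a < b \<and>
      b \<le> row_len (core_diagram l \<mu> r s) a + part \<rho> a * l \<longleftrightarrow>
    a \<le> r + 1 \<and> ?X < b \<and> b \<le> ?X + part \<rho> a * l"
    using core_row_len[OF assms, of a r s] True by auto
  moreover have "b \<le> s + 1 \<and> col_len (core_diagram l \<mu> r s) b < a \<and>
      a \<le> col_len (core_diagram l \<mu> r s) b + part \<sigma> b * l \<longleftrightarrow>
    b \<le> s + 1 \<and> ?Y < a \<and> a \<le> ?Y + part \<sigma> b * l"
    using core_col_len[OF assms, of b s r] True by auto
  moreover have "(a, b) \<in> built_diagram l \<mu> r s \<rho> \<sigma> \<longleftrightarrow> (a, b) \<in> core_diagram l \<mu> r s \<or>
      a \<le> r + 1 \<and> row_len (core_diagram l \<mu> r s) a < b \<and>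
        b \<le> row_len (core_diagram l \<mu> r s) a + part \<rho> a * l \<or>
      b \<le> s + 1 \<and> col_len (core_diagram l \<mu> r s) b < a \<and>
        a \<le> col_len (core_diagram l \<mu> r s) b + part \<sigma> b * l"
    unfolding built_diagram_def Let_def Un_iff mem_Collect_eq case_prod_conv using True by blast
  moreover have "(a, b) \<in> core_diagram l \<mu> r s \<longleftrightarrow>
      shape l (part \<mu>) (col_len (diagram \<mu>)) r s (\<lambda>_. 0) (\<lambda>_. 0) a b"
    using True core_diagram_iff[OF assms] by blast
  moreover have "b \<le> ?X + part \<rho> a * l \<longleftrightarrow> b \<le> ?X + 0 * l \<or> ?X < b \<and> b \<le> ?X + part \<rho> a * l"
    by linarith
  moreover have "a \<le> ?Y + part \<sigma> b * l \<longleftrightarrow> a \<le> ?Y + 0 * l \<or> ?Y < a \<and> a \<le> ?Y + part \<sigma> b * l"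
    by linarith
  ultimately show ?thesis
    unfolding shape_def using True by blast
next
  case False
  then show ?thesis
    by (auto simp: built_diagram_def Let_def core_diagram_iff[OF assms])
qed

lemma has_form_iff:
  assumes "is_partition p" "is_partition \<mu>" "2 \<le> l"
  shows "has_form l p \<mu> r s \<rho> \<sigma> \<longleftrightarrow> (\<forall>a b. 1 \<le> a \<longrightarrow> 1 \<le> b \<longrightarrow> (b \<le> part p a \<longleftrightarrow>
    shape l (part \<mu>) (col_len (diagram \<mu>)) r s (part \<rho>) (part \<sigma>) a b))"
  unfolding has_form_def using assms(1)
  by (auto simp: set_eq_iff built_diagram_iff[OF assms(2,3)] diagram_def)

section \<open>The shape as a Young diagram\<close>

text \<open>A box of \<mu> moved up into the first \<open>r + 1\<close> rows stays inside because
  those rows have at least \<open>s + m 1\<close> boxes. Closure to the left is the same fact for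
  the swapped data.\<close>

lemma shape_up:
  assumes "conj_funs m n" "\<forall>a\<ge>1. \<forall>a'\<ge>a. P a' \<le> P a"
    and "shape l m n r s P Q a b" "1 \<le> a'" "a' \<le> a"
  shows "shape l m n r s P Q a' b"
  using assms(3) unfolding shape_def
proof (elim disjE)
  assume *: "r < a \<and> s < b \<and> b \<le> s + m (a - r)"
  show "r < a' \<and> s < b \<and> b \<le> s + m (a' - r) \<or>
     a' \<le> r + 1 \<and> b \<le> s + m 1 + stair l r a' + P a' * l \<or>
     b \<le> s + 1 \<and> a' \<le> r + n 1 + stair l s b + Q b * l"
  proof (cases "a' \<le> r + 1")
    case True
    have "1 \<le> a - r" using * by linarith
    then show ?thesis using * True conj_funs_antimono[OF assms(1), of 1 "a - r"] by auto
  next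
    case False
    then have "1 \<le> a' - r" "a' - r \<le> a - r" using assms(5) by linarith+
    then show ?thesis using * False conj_funs_antimono[OF assms(1), of "a' - r" "a - r"] by auto
  qed
next
  assume *: "a \<le> r + 1 \<and> b \<le> s + m 1 + stair l r a + P a * l"
  have "stair l r a \<le> stair l r a'" "P a * l \<le> P a' * l"
    using assms(2,4,5) by (simp_all add: stair_antimono)
  then show "r < a' \<and> s < b \<and> b \<le> s + m (a' - r) \<or>
     a' \<le> r + 1 \<and> b \<le> s + m 1 + stair l r a' + P a' * l \<or>
     b \<le> s + 1 \<and> a' \<le> r + n 1 + stair l s b + Q b * l"
    using * assms(5) by linarith
next
  assume "b \<le> s + 1 \<and> a \<le> r + n 1 + stair l s b + Q b * l"
  then show "r < a' \<and> s < b \<and> b \<le> s + m (a' - r) \<or>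
     a' \<le> r + 1 \<and> b \<le> s + m 1 + stair l r a' + P a' * l \<or>
     b \<le> s + 1 \<and> a' \<le> r + n 1 + stair l s b + Q b * l"
    using assms(5) by auto
qed

lemma shape_bound:
  assumes "conj_funs m n" "\<forall>a\<ge>1. \<forall>a'\<ge>a. P a' \<le> P a"
    and "shape l m n r s P Q a b" "1 \<le> a"
  shows "b \<le> s + 1 + m 1 + stair l r 0 + P 1 * l"
proof -
  have P: "P a * l \<le> P 1 * l" "stair l r a \<le> stair l r 0"
    using assms(2,4) by (auto intro!: mult_le_mono1 stair_antimono simp del: One_nat_def)
  have "m (a - r) \<le> m 1" if "r < a"
    using that conj_funs_antimono[OF assms(1), of 1 "a - r"] by simp
  then show ?thesis using assms(3) P unfolding shape_def by linarith
qed

text \<open>The shape is bounded and closed upwards and to the left, so it has row and column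
  lengths. This is why the construction always yields a partition.\<close>

lemma shape_conj_funs:
  assumes "conj_funs m n" "\<forall>a\<ge>1. \<forall>a'\<ge>a. P a' \<le> P a"
    "\<forall>a\<ge>1. \<forall>a'\<ge>a. Q a' \<le> Q a"
  obtains f g where "conj_funs f g"
    "\<And>a b. 1 \<le> a \<Longrightarrow> 1 \<le> b \<Longrightarrow> b \<le> f a \<longleftrightarrow> shape l m n r s P Q a b"
proof -
  let ?S = "shape l m n r s P Q"
  let ?D = "{(a, b). 1 \<le> a \<and> 1 \<le> b \<and> ?S a b}"
  note nm = conj_funs_sym[OF assms(1)]
  have swap: "?S a b \<longleftrightarrow> shape l n m s r Q P b a" for a b
    using shape_swap[OF assms(1)] by blast
  have fin: "finite ?D"
  proof (rule finite_subset)
    show "?D \<subseteq> {..r + 1 + n 1 + stair l s 0 + Q 1 * l} \<times>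
        {..s + 1 + m 1 + stair l r 0 + P 1 * l}"
      using shape_bound[OF assms(1,2), where Q = Q] shape_bound[OF nm assms(3), where Q = P] swap
      by blast
  qed simp
  have down: "(a', b') \<in> ?D" if "(a, b) \<in> ?D" "1 \<le> a'" "a' \<le> a" "1 \<le> b'" "b' \<le> b" for a b a' b'
  proof -
    have "?S a' b" using shape_up[OF assms(1,2)] that by blast
    then have "?S a' b'" using shape_up[OF nm assms(3)] that swap by blast
    then show ?thesis using that by blast
  qed
  have pos: "1 \<le> a \<and> 1 \<le> b" if "(a, b) \<in> ?D" for a b
    using that by blast
  show ?thesis
  proof (rule that[of "row_len ?D" "col_len ?D"])
    show "conj_funs (row_len ?D) (col_len ?D)"
      using fin pos down by (rule young_set(3))
    show "b \<le> row_len ?D a \<longleftrightarrow> ?S a b" if "1 \<le> a" "1 \<le> b" for a b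
      using young_set(1)[of ?D, OF fin pos _ that] down that by blast
  qed
qed

section \<open>Every constructed partition is a JM partition\<close>

text \<open>Divisibility depends on row \<open>a\<close> only through the residue of its row term,
  for which any representative \<open>c\<close> may be taken.\<close>

lemma dvd_hook_add:
  assumes "int (f a) - int a = c + int l * k"
  shows "int l dvd hook f g a b \<longleftrightarrow> int l dvd c + (int (g b) - int b) + 1"
proof -
  have "hook f g a b = (c + (int (g b) - int b) + 1) + k * int l"
    unfolding hook_def assms by simp
  then show ?thesis by (simp only: dvd_add_times_triv_right_iff)
qed

text \<open>One row up, the length gains \<open>l - 1\<close> and the index loses 1, a total of
  \<open>l\<close>; rim hooks also add multiples of \<open>l\<close>. Hence all frame lines are
  congruent to line \<open>k + 1\<close>.\<close>

lemma content_stair: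
  assumes "a \<le> k + 1" "1 \<le> l"
  shows "int (K + stair l k a + p * l) - int a = int K - int (k + 1) + int l * int (k + 1 - a + p)"
proof -
  have "int (stair l k a) = int (k + 1 - a) * (int l - 1)"
    using assms(2) by (simp add: stair_def of_nat_diff)
  then show ?thesis using assms(1) by (simp add: algebra_simps of_nat_diff)
qed

text \<open>Columns reach at most \<open>s + 1\<close>, which the row segment contains unless
  \<open>a = r + 1\<close> and \<mu> is empty. In that case vertical rim hooks in column
  \<open>s + 1\<close> would lengthen the row, and the condition on \<open>Q\<close> excludes
  them.\<close>

lemma shape_row_top:
  assumes "conj_funs m n" "2 \<le> l" "m 1 = 0 \<Longrightarrow> Q (s + 1) = 0"
    and "\<forall>a\<ge>1. \<forall>b\<ge>1. b \<le> f a \<longleftrightarrow> shape l m n r s P Q a b" "1 \<le> a" "a \<le> r + 1"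
  shows "f a = s + m 1 + stair l r a + P a * l"
proof (rule eq_of_le_iff)
  fix b :: nat assume b: "1 \<le> b"
  have mn: "m 1 = 0 \<Longrightarrow> n 1 = 0" using conj_funsD[OF assms(1), of 1 1] by simp
  consider "a \<le> r" | "a = r + 1" using assms(6) by linarith
  then have "b \<le> s + m 1 + stair l r a + P a * l" if "shape l m n r s P Q a b"
  proof cases
    case 1
    then show ?thesis using that assms(2) stair_pos[of a r l] unfolding shape_def by linarith
  next
    case 2
    have "b \<le> s" if "b \<le> s + 1" "a \<le> r + n 1 + stair l s b + Q b * l" "m 1 = 0"
      using that mn assms(3) 2 by (cases "b = s + 1") auto
    then show ?thesis using that 2 unfolding shape_def by force
  qed
  then show "b \<le> f a \<longleftrightarrow> b \<le> s + m 1 + stair l r a + P a * l"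
    using assms(4,5,6) b unfolding shape_def by blast
qed

lemma shape_row_inner:
  assumes "conj_funs m n" "2 \<le> l"
    and "\<forall>a\<ge>1. \<forall>b\<ge>1. b \<le> f a \<longleftrightarrow> shape l m n r s P Q a b" "1 \<le> a" "r + 1 < a" "a \<le> r + n 1"
  shows "f a = s + m (a - r)"
proof (rule eq_of_le_iff)
  fix b :: nat assume b: "1 \<le> b"
  have m: "1 \<le> m (a - r)" using conj_funsD[OF assms(1), of "a - r" 1] assms(5,6) by simp
  have "shape l m n r s P Q a b \<longleftrightarrow> b \<le> s + m (a - r)"
    unfolding shape_def using m assms(5,6) by auto
  then show "b \<le> f a \<longleftrightarrow> b \<le> s + m (a - r)" using assms(3,4) b by simp
qed

lemma shape_row_bottom:
  assumes "conj_funs m n" "m 1 = 0 \<Longrightarrow> Q (s + 1) = 0"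
    and "\<forall>a\<ge>1. \<forall>b\<ge>1. b \<le> f a \<longleftrightarrow> shape l m n r s P Q a b" "1 \<le> a" "r + 1 < a" "r + n 1 < a"
  shows "f a \<le> s + 1" "m 1 = 0 \<Longrightarrow> f a \<le> s"
proof -
  have 0: "m (a - r) = 0" using conj_funsD[OF assms(1), of "a - r" 1] assms(5,6) by fastforce
  show "f a \<le> s + 1"
  proof (rule ccontr)
    assume "\<not> f a \<le> s + 1"
    then have "shape l m n r s P Q a (s + 2)" using assms(3)[rule_format, OF assms(4), of "s + 2"] by simp
    then show False using 0 assms(5) by (simp add: shape_def)
  qed
  show "f a \<le> s" if "m 1 = 0"
  proof (rule ccontr)
    assume "\<not> f a \<le> s"
    then have "shape l m n r s P Q a (s + 1)" using assms(3)[rule_format, OF assms(4), of "s + 1"] by simp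
    then show False using 0 assms(2)[OF that] assms(5,6) by (simp add: shape_def)
  qed
qed

lemma shape_jm:
  assumes mn: "conj_funs m n" and fg: "conj_funs f g" and l: "2 \<le> l"
    and core: "\<forall>a\<ge>1. \<forall>b\<ge>1. b \<le> m a \<longrightarrow> \<not> int l dvd hook m n a b"
    and Q: "m 1 = 0 \<Longrightarrow> Q (s + 1) = 0"
    and sh: "\<forall>a\<ge>1. \<forall>b\<ge>1. b \<le> f a \<longleftrightarrow> shape l m n r s P Q a b"
  shows "jm_funs l f g"
  unfolding jm_funs_def
proof (intro allI impI)
  fix a b :: nat
  assume ab: "1 \<le> a" "1 \<le> b" "b \<le> f a" and dvd: "int l dvd hook f g a b"
  note nm = conj_funs_sym[OF mn]
  have m1n1: "m 1 = 0 \<longleftrightarrow> n 1 = 0" using conj_funsD[OF mn, of 1 1] by auto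
  have sh': "\<forall>b\<ge>1. \<forall>a\<ge>1. a \<le> g b \<longleftrightarrow> shape l n m s r Q P b a"
    using sh conj_funsD[OF fg] shape_swap[OF mn] by blast
  have ftop: "f x = s + m 1 + stair l r x + P x * l" if "1 \<le> x" "x \<le> r + 1" for x
    using shape_row_top[OF mn l Q sh that] .
  \<comment> \<open>The bound \<open>y \<le> s + m 1\<close> leaves out column \<open>s + 1\<close>
    when \<mu> is empty: horizontal rim hooks in row \<open>r + 1\<close> may then cross this column
    and make it longer than the formula says.\<close>
  have gtop: "g y = r + n 1 + stair l s y + Q y * l" if "1 \<le> y" "y \<le> s + 1" "y \<le> s + m 1" for y
  proof (cases "m 1 = 0")
    case False
    then show ?thesis using shape_row_top[OF nm l _ sh' that(1,2)] m1n1 by simp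
  next
    case True
    then have "1 \<le> stair l s y" using stair_pos[of y s l] that l by simp
    moreover have "n y' = 0" if "1 \<le> y'" for y'
      using conj_funs_antimono[OF nm _ that] m1n1 True by simp
    ultimately have "shape l n m s r Q P y x \<longleftrightarrow> x \<le> r + n 1 + stair l s y + Q y * l" for x
      using that True m1n1 unfolding shape_def by auto
    then show ?thesis using sh' that(1) by (intro eq_of_le_iff) blast
  qed
  have frow: "\<exists>k. int (f x) - int x = int (s + m 1) - int (r + 1) + int l * k"
    if "1 \<le> x" "x \<le> r + 1" for x
    using content_stair[OF that(2), of l "s + m 1" "P x"] l unfolding ftop[OF that] by auto
  have gcol: "\<exists>k. int (g y) - int y = int (r + n 1) - int (s + 1) + int l * k"
    if "1 \<le> y" "y \<le> s + 1" "y \<le> s + m 1" for y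
    using content_stair[OF that(2), of l "r + n 1" "Q y"] l unfolding gtop[OF that] by auto
  have rows: "int l dvd hook f g x b" if "1 \<le> x" "x \<le> r + 1" "a \<le> r + 1" for x
    using dvd frow[OF that(1,2)] frow[OF ab(1) that(3)] dvd_hook_add by metis
  have cols: "int l dvd hook f g a y" if "1 \<le> y" "y \<le> s + 1" "y \<le> s + m 1" "b \<le> s + 1" "b \<le> s + m 1" for y
    using dvd gcol[OF that(1-3)] gcol[OF ab(2) that(4,5)] dvd_hook_add hook_swap by metis
  consider (right) "s + m 1 < b" | (below) "r + n 1 < a" "r + 1 < a"
    | (inner) "b \<le> s + m 1" "a \<le> r + n 1 \<or> a \<le> r + 1" by linarith
  then show "(\<forall>y. 1 \<le> y \<and> y \<le> f a \<longrightarrow> int l dvd hook f g a y) \<or>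
    (\<forall>x. 1 \<le> x \<and> x \<le> g b \<longrightarrow> int l dvd hook f g x b)"
  proof cases
    case right
    \<comment> \<open>Column \<open>b\<close> stops before row \<open>r + 2\<close>. The delicate
      column is \<open>s + 1\<close>: it lies to the right only if \<mu> is empty, and then it has
      no vertical rim hooks.\<close>
    have "\<not> shape l m n r s P Q (r + 2) b"
    proof
      assume "shape l m n r s P Q (r + 2) b"
      moreover have "m 2 \<le> m 1" using conj_funs_antimono[OF mn, of 1 2] by simp
      moreover have "n 1 = 0 \<and> Q (s + 1) = 0" if "b \<le> s + 1" using that right m1n1 Q by auto
      ultimately show False using right by (cases "b = s + 1") (auto simp: shape_def)
    qed
    then have "g b \<le> r + 1" using sh conj_funsD[OF fg, of "r + 2" b] ab by force
    moreover have "a \<le> g b" using conj_funsD[OF fg ab(1,2)] ab(3) by blast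
    ultimately show ?thesis using rows by force
  next
    case below
    have "f a \<le> s + 1" "m 1 = 0 \<Longrightarrow> f a \<le> s"
      using shape_row_bottom[OF mn Q sh ab(1) below(2,1)] by blast+
    then have "f a \<le> s + 1" "f a \<le> s + m 1" by linarith+
    then show ?thesis using cols ab(3) by (meson le_trans)
  next
    case inner
    \<comment> \<open>The position \<open>(a0, b0)\<close> in \<mu> represents the residues of row
      \<open>a\<close> and column \<open>b\<close>: all frame lines are represented by the first row
      or column of \<mu>. If \<mu> is nonempty, it turns out to be a box of \<mu>.\<close>
    define a0 where "a0 = (if a \<le> r + 1 then 1 else a - r)"
    define b0 where "b0 = (if b \<le> s + 1 then 1 else b - s)"
    have "\<exists>k. int (f a) - int a = int (s + m a0) - int (r + a0) + int l * k"
    proof (cases "a \<le> r + 1")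
      case True
      then show ?thesis using frow[OF ab(1)] by (simp add: a0_def)
    next
      case False
      then have "f a = s + m (a - r)"
        using shape_row_inner[OF mn l sh ab(1)] inner(2) by force
      then show ?thesis using False by (intro exI[of _ 0]) (simp add: a0_def)
    qed
    then obtain k where k: "int (f a) - int a = int (s + m a0) - int (r + a0) + int l * k" ..
    have "\<exists>k. int (g b) - int b = int (r + n b0) - int (s + b0) + int l * k"
    proof (cases "b \<le> s + 1")
      case True
      then show ?thesis using gcol[OF ab(2)] inner(1) by (simp add: b0_def)
    next
      case False
      then have "g b = r + n (b - s)"
        using shape_row_inner[OF nm l sh' ab(2)] inner(1) by force
      then show ?thesis using False by (intro exI[of _ 0]) (simp add: b0_def)
    qed
    then obtain k' where k': "int (g b) - int b = int (r + n b0) - int (s + b0) + int l * k'" ..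
    have "hook f g a b = hook m n a0 b0 + int l * (k + k')"
      unfolding hook_def k k' by (simp add: algebra_simps)
    then have dvd0: "int l dvd hook m n a0 b0" using dvd by (metis dvd_add_times_triv_right_iff mult.commute)
    show ?thesis
    proof (cases "m 1 = 0")
      case True
      then have "a0 = 1" "b0 = 1" using inner m1n1 by (auto simp: a0_def b0_def)
      then have "hook m n a0 b0 = -1" using True m1n1 by (simp add: hook_def)
      then show ?thesis using dvd0 l by (simp add: zdvd_not_zless)
    next
      case False
      have "b0 \<le> m a0"
      proof (cases "a \<le> r + 1")
        case True
        then show ?thesis using False inner by (auto simp: a0_def b0_def)
      next
        case a: False
        show ?thesis
        proof (cases "b \<le> s + 1")
          case True
          then show ?thesis using a inner conj_funsD[OF mn, of "a - r" 1] by (simp add: a0_def b0_def)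
        next
          case False
          then show ?thesis using a ab sh by (auto simp: a0_def b0_def shape_def)
        qed
      qed
      moreover have "1 \<le> a0" "1 \<le> b0" by (auto simp: a0_def b0_def)
      ultimately show ?thesis using core dvd0 by blast
    qed
  qed
qed

lemma shape_cong:
  assumes "\<And>a. 1 \<le> a \<Longrightarrow> m a = m' a" "\<And>b. 1 \<le> b \<Longrightarrow> n b = n' b"
    "P a = P' a" "Q b = Q' b"
  shows "shape l m n r s P Q a b \<longleftrightarrow> shape l m' n' r s P' Q' a b"
  unfolding shape_def using assms by (auto simp: Suc_le_eq)

lemma part_eq_0_iff: "is_partition p \<Longrightarrow> part p 1 = 0 \<longleftrightarrow> p = []"
  by (cases p) (auto simp: part_def is_partition_def)

lemma admissible_ex1_jm:
  assumes l: "2 \<le> l" and adm: "admissible l \<mu> r s \<rho> \<sigma>"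
  shows "\<exists>!p. has_form l p \<mu> r s \<rho> \<sigma>"
    and "has_form l p \<mu> r s \<rho> \<sigma> \<Longrightarrow> is_JM l p"
proof -
  let ?m = "part \<mu>" and ?n = "col_len (diagram \<mu>)"
  have \<mu>: "is_partition \<mu>" and core: "is_core l \<mu>"
    and \<rho>: "is_partition \<rho>" and \<sigma>: "is_partition \<sigma>"
    and empty: "\<mu> = [] \<Longrightarrow> part \<rho> (r + 1) = 0 \<or> part \<sigma> (s + 1) = 0"
    using adm by (auto simp: admissible_def is_core_def)
  have mn: "conj_funs ?m ?n" by (rule conj_funs_part[OF \<mu>])
  obtain f g where fg: "conj_funs f g"
    and sh: "\<And>a b. 1 \<le> a \<Longrightarrow> 1 \<le> b \<Longrightarrow>
      b \<le> f a \<longleftrightarrow> shape l ?m ?n r s (part \<rho>) (part \<sigma>) a b"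
    using shape_conj_funs[OF mn, of "part \<rho>" "part \<sigma>"] part_antimono \<rho> \<sigma> by metis
  have "f a = 0" if "g 1 < a" for a
    using conj_funsD[OF fg, of a 1] that by auto
  then obtain p where p: "is_partition p" "\<And>a. 1 \<le> a \<Longrightarrow> part p a = f a"
    using partition_of_fun[of f "g 1"] conj_funs_antimono[OF fg] by metis
  have "has_form l p \<mu> r s \<rho> \<sigma>"
    using has_form_iff[OF p(1) \<mu> l] p(2) sh by simp
  moreover have "p' = p" if "has_form l p' \<mu> r s \<rho> \<sigma>" for p'
    using that \<open>has_form l p \<mu> r s \<rho> \<sigma>\<close> diagram_inject unfolding has_form_def by metis
  ultimately show "\<exists>!p. has_form l p \<mu> r s \<rho> \<sigma>" by blast
  show "is_JM l p" if form: "has_form l p \<mu> r s \<rho> \<sigma>" for p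
  proof -
    have p: "is_partition p" using form by (simp add: has_form_def)
    let ?f = "part p" and ?g = "col_len (diagram p)"
    have fg: "conj_funs ?f ?g" by (rule conj_funs_part[OF p])
    have sh: "\<forall>a\<ge>1. \<forall>b\<ge>1. b \<le> ?f a \<longleftrightarrow> shape l ?m ?n r s (part \<rho>) (part \<sigma>) a b"
      using form has_form_iff[OF p \<mu> l] by blast
    have co: "\<forall>a\<ge>1. \<forall>b\<ge>1. b \<le> ?m a \<longrightarrow> \<not> int l dvd hook ?m ?n a b"
      using core is_core_iff[OF \<mu> mn] by blast
    have "jm_funs l ?f ?g"
    \<comment> \<open>For empty \<mu> only one of the two rim hook conditions is available. If it is
      the one on \<open>part \<rho>\<close>, the conjugate diagram is used.\<close>
    proof (cases "?m 1 = 0 \<longrightarrow> part \<sigma> (s + 1) = 0")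
      case True
      show ?thesis by (rule shape_jm[OF mn fg l co _ sh]) (use True in blast)
    next
      case False
      then have P: "?n 1 = 0 \<Longrightarrow> part \<rho> (r + 1) = 0"
        using empty part_eq_0_iff[OF \<mu>] by blast
      have sh': "\<forall>a\<ge>1. \<forall>b\<ge>1. b \<le> ?g a \<longleftrightarrow> shape l ?n ?m s r (part \<sigma>) (part \<rho>) a b"
        using sh shape_swap[OF mn] conj_funsD[OF fg] by blast
      have co': "\<forall>b\<ge>1. \<forall>a\<ge>1. a \<le> ?n b \<longrightarrow> \<not> int l dvd hook ?n ?m b a"
        using co conj_funsD[OF mn] unfolding hook_swap[of ?n ?m] by blast
      have "jm_funs l ?g ?f"
        by (rule shape_jm[OF conj_funs_sym[OF mn] conj_funs_sym[OF fg] l co' P sh'])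
      then show ?thesis using jm_funs_swap[OF fg] by blast
    qed
    then show ?thesis using is_JM_iff[OF p fg] by blast
  qed
qed

section \<open>Every JM partition is constructed\<close>

lemma stair_Suc: "i \<le> k \<Longrightarrow> stair l k i = stair l k (Suc i) + (l - 1)"
  by (simp add: stair_def Suc_diff_le)

lemma stair_SucSuc: "i \<le> Suc k \<Longrightarrow> stair l (Suc k) i = stair l k i + (l - 1)"
  by (simp add: stair_def Suc_diff_le)

text \<open>Each divisibility makes a row longer than the next by \<open>l - 1\<close> plus a
  nonnegative multiple of \<open>l\<close>. Summed from row \<open>r + 1\<close> upwards, the
  \<open>l - 1\<close> form the staircase and the multiples give the weakly decreasing rim hook
  counts \<open>P\<close>.\<close>

lemma ladder:
  assumes l: "2 \<le> l" and anti: "\<And>i. 1 \<le> i \<Longrightarrow> f (Suc i) \<le> f i"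
    and dvd: "\<And>i. 1 \<le> i \<Longrightarrow> i \<le> r \<Longrightarrow> l dvd Suc (f i - f (Suc i))"
    and K: "f (Suc r) = K + q * l"
  obtains P where "\<forall>a\<ge>1. \<forall>a'\<ge>a. P a' \<le> P a" "\<And>a. r + 1 < a \<Longrightarrow> P a = 0" "P (r + 1) = q"
    "\<forall>i\<ge>1. i \<le> r + 1 \<longrightarrow> f i = K + stair l r i + P i * l"
proof -
  have climb: "\<exists>k'. f i = K + stair l r i + k' * l \<and> k \<le> k'"
    if "1 \<le> i" "i \<le> r" "f (Suc i) = K + stair l r (Suc i) + k * l" for i k
  proof -
    have "l dvd Suc (f i - f (Suc i))" using dvd[OF that(1,2)] .
    then obtain c where c: "Suc (f i - f (Suc i)) = l * c" by blast
    \<comment> \<open>\<open>c\<close> is nonzero because the left side is a successor, so the drop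
      is at least \<open>l - 1\<close>.\<close>
    then obtain c' where c': "c = Suc c'" by (cases c) auto
    have "f i = f (Suc i) + (l - 1) + c' * l"
      using c anti[OF that(1)] l unfolding c' by (simp add: mult.commute)
    then show ?thesis
      using that(3) stair_Suc[OF that(2), of l] by (intro exI[of _ "k + c'"]) (simp add: algebra_simps)
  qed
  have ex: "\<exists>k. f i = K + stair l r i + k * l" if "i \<le> r + 1" "1 \<le> i" for i
    using that
  proof (induction rule: inc_induct)
    case base
    then show ?case using K by auto
  next
    case (step i)
    then show ?case using climb[of i] by fastforce
  qed
  define P where "P i = (if i \<le> r + 1 then (f i - K - stair l r i) div l else 0)" for i
  have P: "f i = K + stair l r i + P i * l" if "1 \<le> i" "i \<le> r + 1" for i
    using ex[OF that(2,1)] that l by (auto simp: P_def)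
  have Psuc: "P (Suc i) \<le> P i" if "1 \<le> i" for i
  proof (cases "i \<le> r")
    case True
    have "\<exists>k'. f i = K + stair l r i + k' * l \<and> P (Suc i) \<le> k'"
      using climb[OF that True, of "P (Suc i)"] P[of "Suc i"] True by auto
    then obtain k' where "f i = K + stair l r i + k' * l" "P (Suc i) \<le> k'" by blast
    then show ?thesis using P[OF that] True l by simp
  qed (simp add: P_def)
  have "\<forall>a\<ge>1. \<forall>a'\<ge>a. P a' \<le> P a"
  proof (intro allI impI)
    fix a a' :: nat assume "1 \<le> a" "a \<le> a'"
    then show "P a' \<le> P a"
      using lift_Suc_antimono_le[of "\<lambda>i. P (Suc i)" "a - 1" "a' - 1"] Psuc by simp
  qed
  moreover have "P (r + 1) = q"
    using P[of "r + 1"] K l by simp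
  moreover have "P a = 0" if "r + 1 < a" for a
    using that by (simp add: P_def)
  ultimately show ?thesis using that P by blast
qed

text \<open>The congruences must break off: just below the diagram both lengths are 0 and the tested
  number is 1.\<close>

lemma maximal_ladder:
  assumes "conj_funs f g" "2 \<le> l"
  obtains r where "\<And>i. 1 \<le> i \<Longrightarrow> i \<le> r \<Longrightarrow> l dvd Suc (f i - f (Suc i))"
    "\<not> l dvd Suc (f (Suc r) - f (Suc (Suc r)))"
proof -
  let ?A = "\<lambda>r. \<not> l dvd Suc (f (Suc r) - f (Suc (Suc r)))"
  have "f (Suc (g 1)) = 0" using conj_funsD[OF assms(1), of "Suc (g 1)" 1] by simp
  then have A: "?A (g 1)" using assms(2) by simp
  define r where "r = (LEAST r. ?A r)"
  have "?A r" unfolding r_def using A by (rule LeastI)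
  moreover have "l dvd Suc (f i - f (Suc i))" if "1 \<le> i" "i \<le> r" for i
    using not_less_Least[of "i - 1" ?A] that by (simp add: r_def)
  ultimately show ?thesis using that by blast
qed

text \<open>The rows and columns of \<open>\<mu>\<close>: the first row and the first column of the remaining diagram
  lose the attached rim hooks, the deeper rows and columns are kept.\<close>

definition trim :: "(nat \<Rightarrow> nat) \<Rightarrow> nat \<Rightarrow> nat \<Rightarrow> nat \<Rightarrow> nat \<Rightarrow> nat \<Rightarrow> nat" where
  "trim f r s M N a = (if a \<le> 1 then M else if a \<le> N then f (r + a) - s else 0)"

text \<open>\<open>r\<close> and \<open>s\<close> are chosen maximal with congruent contents in the rows \<open>1, \<dots>, r + 1\<close> and in
  the columns \<open>1, \<dots>, s + 1\<close>; \<open>q\<close> and \<open>q'\<close> count the rim hooks in row \<open>r + 1\<close> and column \<open>s + 1\<close>.\<close>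

locale jm_corner =
  fixes l :: nat and f g :: "nat \<Rightarrow> nat" and r s K K' q q' :: nat
  assumes l: "3 \<le> l" and fg: "conj_funs f g" and jm: "jm_funs l f g"
    and rdvd: "\<And>i. 1 \<le> i \<Longrightarrow> i \<le> r \<Longrightarrow> l dvd Suc (f i - f (Suc i))"
    and fK: "f (r + 1) = K + q * l" and K: "f (r + 2) \<le> K" "K < f (r + 2) + (l - 1)"
    and cdvd: "\<And>j. 1 \<le> j \<Longrightarrow> j \<le> s \<Longrightarrow> l dvd Suc (g j - g (Suc j))"
    and gK: "g (s + 1) = K' + q' * l" and K': "g (s + 2) \<le> K'" "K' < g (s + 2) + (l - 1)"
begin

text \<open>All assumptions are symmetric under conjugation, so interpreting the locale with swapped
  data turns each fact on rows into one on columns.\<close>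

lemma swap: "jm_corner l g f s r K' K q' q"
  using l conj_funs_sym[OF fg] jm_funs_swap[OF fg] jm rdvd fK K cdvd gK K'
  by (simp add: jm_corner_def)

lemma iff: "1 \<le> a \<Longrightarrow> 1 \<le> b \<Longrightarrow> b \<le> f a \<longleftrightarrow> a \<le> g b"
  by (rule conj_funsD[OF fg])

section \<open>Position of the frame in the diagram\<close>

lemma row_drop: "f (r + 1) + 2 \<le> f r" if "1 \<le> r"
proof -
  have "l \<le> Suc (f r - f (r + 1))"
    using rdvd[of r] that by (intro dvd_imp_le) auto
  then show ?thesis using l by linarith
qed

text \<open>Otherwise row \<open>r\<close> ends within the first \<open>s\<close> columns. It
  exceeds row \<open>r + 1\<close> by at least 2 boxes, so its last two columns both have length
  \<open>r\<close>, whereas the column congruence would make \<open>l\<close> divide 1.\<close>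

lemma corner_row: "s + 1 \<le> f r" if r: "1 \<le> r"
proof (rule ccontr)
  assume neg: "\<not> s + 1 \<le> f r"
  have eq: "g c = r" if "f (r + 1) < c" "c \<le> f r" for c
    using iff[of r c] iff[of "r + 1" c] that r by auto
  have "l dvd Suc (g (f r - 1) - g (Suc (f r - 1)))"
    using neg row_drop[OF r] by (intro cdvd) linarith+
  then show False using eq[of "f r"] eq[of "f r - 1"] row_drop[OF r] l by simp
qed

text \<open>By \<open>corner_row\<close>, column \<open>s + 1\<close> has length at least
  \<open>r\<close>, and column \<open>s\<close> is longer by at least 2. Thus
  \<open>s \<le> K\<close>, and subtracting \<open>s\<close> does not truncate.\<close>

lemma low_row: "s \<le> f (r + 2)"
proof (cases "s = 0")
  case False
  interpret sw: jm_corner l g f s r K' K q' q by (rule swap)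
  have "r \<le> g (s + 1)" using corner_row iff[of r "s + 1"] by (cases "r = 0") auto
  then have "r + 2 \<le> g s" using sw.row_drop False by simp
  then show ?thesis using iff[of "r + 2" s] False by simp
qed simp

text \<open>Stripping rim hooks from row \<open>r + 1\<close> and column \<open>s + 1\<close> keeps
  them at least as long as their successors, so deeper boxes stay under the shortened first row and
  column.\<close>

lemma inner_box: "s + b \<le> f (r + a) \<Longrightarrow> 2 \<le> a \<Longrightarrow> 2 \<le> b \<Longrightarrow> a \<le> K' - r \<and> b \<le> K - s"
proof -
  assume *: "s + b \<le> f (r + a)" "2 \<le> a" "2 \<le> b"
  have "f (r + a) \<le> f (r + 2)" using conj_funs_antimono[OF fg, of "r + 2" "r + a"] * by simp
  moreover have "g (s + b) \<le> g (s + 2)"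
    using conj_funs_antimono[OF conj_funs_sym[OF fg], of "s + 2" "s + b"] * by simp
  moreover have "r + a \<le> g (s + b)" using iff[of "r + a" "s + b"] * by simp
  ultimately show ?thesis using * K(1) K'(1) by linarith
qed

text \<open>Modulo \<open>l\<close> the number is \<open>K' - g (s + 2) + 1\<close>, which lies
  between 1 and \<open>l - 1\<close>.\<close>

lemma not_dvd_col: "\<not> int l dvd int (g (s + 1)) - int (g (s + 2)) + 1"
proof
  assume "int l dvd int (g (s + 1)) - int (g (s + 2)) + 1"
  moreover have "int (g (s + 1)) - int (g (s + 2)) + 1 = (int K' - int (g (s + 2)) + 1) + int q' * int l"
    using gK by simp
  ultimately have "int l dvd int K' - int (g (s + 2)) + 1"
    by (metis dvd_add_times_triv_right_iff)
  then show False using K' by (auto dest!: zdvd_imp_le)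
qed

text \<open>If the row reaches column \<open>s + 2\<close>, its hooks in columns
  \<open>s + 1\<close> and \<open>s + 2\<close> are incongruent. If it ends at \<open>s + 1\<close>,
  its last hook is congruent to \<open>K' - r - a + 1\<close>, which is positive and less than
  \<open>l\<close>.\<close>

lemma row_not_all_dvd:
  assumes a: "1 \<le> a" "a \<le> K' - r" and b: "1 \<le> b" "s + b \<le> f (r + a)"
  shows "\<exists>y. 1 \<le> y \<and> y \<le> f (r + a) \<and> \<not> int l dvd hook f g (r + a) y"
proof (rule ccontr)
  assume "\<not> ?thesis"
  then have all: "int l dvd hook f g (r + a) y" if "1 \<le> y" "y \<le> f (r + a)" for y using that by blast
  show False
  proof (cases "s + 2 \<le> f (r + a)")
    case True
    then have "int l dvd hook f g (r + a) (s + 1) - hook f g (r + a) (s + 2)"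
      using all by (intro dvd_diff) auto
    moreover have "hook f g (r + a) (s + 1) - hook f g (r + a) (s + 2) =
        int (g (s + 1)) - int (g (s + 2)) + 1"
      by (simp add: hook_def)
    ultimately show False using not_dvd_col by (simp only:)
  next
    case False
    then have f: "f (r + a) = s + 1" using b by linarith
    have g2: "g (s + 2) < r + a" using iff[of "r + a" "s + 2"] False a by auto
    have "hook f g (r + a) (s + 1) = (int K' - int r - int a + 1) + int q' * int l"
      using f gK by (simp add: hook_def)
    then have "int l dvd int K' - int r - int a + 1"
      using all[of "s + 1"] f by (metis dvd_add_times_triv_right_iff le_add2 le_refl)
    then have "int l \<le> int K' - int r - int a + 1" using a by (intro zdvd_imp_le) auto
    then show False using K' g2 by linarith
  qed
qed

section \<open>The trimmed diagram\<close>

text \<open>One half of conjugacy; the swapped corner supplies the other. By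
  \<open>inner_box\<close>, the cutoffs in \<open>trim\<close> lose no box outside the first row and
  column.\<close>

lemma trim_le:
  assumes "1 \<le> K - s" "1 \<le> K' - r" "1 \<le> a" "1 \<le> b" "b \<le> trim f r s (K - s) (K' - r) a"
  shows "a \<le> trim g s r (K' - r) (K - s) b"
proof -
  have *: "b \<le> K - s \<and> r + a \<le> g (s + b)" if "2 \<le> b"
  proof (cases "a = 1")
    case True
    then show ?thesis using assms that fK iff[of "r + 1" "s + b"] by (auto simp: trim_def)
  next
    case False
    then have "s + b \<le> f (r + a)" using assms by (auto simp: trim_def split: if_splits)
    then show ?thesis using inner_box[of b a] that False assms iff[of "r + a" "s + b"] by auto
  qed
  have "a \<le> K' - r" using assms by (auto simp: trim_def split: if_splits)
  then show ?thesis using * assms by (auto simp: trim_def)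
qed

lemma trim_conj_funs:
  assumes "1 \<le> K - s" "1 \<le> K' - r"
  shows "conj_funs (trim f r s (K - s) (K' - r)) (trim g s r (K' - r) (K - s))"
proof -
  interpret sw: jm_corner l g f s r K' K q' q by (rule swap)
  show ?thesis unfolding conj_funs_def using trim_le sw.trim_le assms by blast
qed

lemma trim_cong:
  assumes "1 \<le> a" "a \<le> K' - r" "s \<le> f (r + a)"
  shows "\<exists>k. int (trim f r s (K - s) (K' - r) a) = int (f (r + a)) - int s - int l * k"
proof (cases "a = 1")
  case True
  then show ?thesis using K(1) low_row fK by (intro exI[of _ "int q"]) (simp add: trim_def of_nat_diff)
next
  case False
  then show ?thesis using assms by (intro exI[of _ 0]) (simp add: trim_def of_nat_diff)
qed

text \<open>Trimming changes lengths by multiples of \<open>l\<close>, so a divisible hook would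
  give one at the shifted box of the whole diagram. The JM condition then contradicts
  \<open>row_not_all_dvd\<close> or its conjugate.\<close>

lemma trim_core:
  assumes "1 \<le> K - s" "1 \<le> K' - r" "1 \<le> a" "1 \<le> b" "b \<le> trim f r s (K - s) (K' - r) a"
  shows "\<not> int l dvd hook (trim f r s (K - s) (K' - r)) (trim g s r (K' - r) (K - s)) a b"
proof
  let ?m = "trim f r s (K - s) (K' - r)" and ?n = "trim g s r (K' - r) (K - s)"
  interpret sw: jm_corner l g f s r K' K q' q by (rule swap)
  assume dvd: "int l dvd hook ?m ?n a b"
  have a: "a \<le> ?n b" using trim_le[OF assms] .
  have le: "a \<le> K' - r" "b \<le> K - s" using assms a by (auto simp: trim_def split: if_splits)
  have box: "s + b \<le> f (r + a)"
    using assms(3-5) le fK by (cases "a = 1") (auto simp: trim_def split: if_splits)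
  then have box': "r + a \<le> g (s + b)" using iff[of "r + a" "s + b"] assms by simp
  obtain k k' where "int (?m a) = int (f (r + a)) - int s - int l * k"
    "int (?n b) = int (g (s + b)) - int r - int l * k'"
    using trim_cong[OF assms(3) le(1)] sw.trim_cong[OF assms(4) le(2)] box box' by auto
  then have "hook f g (r + a) (s + b) = hook ?m ?n a b + (k + k') * int l"
    by (simp add: hook_def algebra_simps)
  then have "int l dvd hook f g (r + a) (s + b)" using dvd by (simp only: dvd_add_times_triv_right_iff)
  moreover have "1 \<le> r + a" "1 \<le> s + b" using assms by auto
  ultimately have "(\<forall>y. 1 \<le> y \<and> y \<le> f (r + a) \<longrightarrow> int l dvd hook f g (r + a) y) \<or>
      (\<forall>x. 1 \<le> x \<and> x \<le> g (s + b) \<longrightarrow> int l dvd hook f g x (s + b))"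
    using jm box unfolding jm_funs_def by blast
  then show False
    using row_not_all_dvd[OF assms(3) le(1) assms(4) box]
      sw.row_not_all_dvd[OF assms(4) le(2) assms(3) box'] hook_swap[of g f] by metis
qed

text \<open>With two or more rows the bound is the one on \<open>K\<close>. With a single row,
  \<open>f (r + 2) \<le> s + 1\<close> only gives \<open>K - s \<le> l - 1\<close>, and equality is
  the exception.\<close>

lemma trim_diff:
  assumes "1 \<le> K - s" "1 \<le> K' - r"
  shows "trim f r s (K - s) (K' - r) 1 - trim f r s (K - s) (K' - r) 2 < l - 1 \<or>
    K' - r = 1 \<and> K - s = l - 1"
proof (cases "2 \<le> K' - r")
  case True
  then show ?thesis using K low_row by (auto simp: trim_def)
next
  case False
  then have "f (r + 2) \<le> s + 1" using inner_box[of 2 2] by linarith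
  then show ?thesis using K False assms by (auto simp: trim_def)
qed

text \<open>Here \<open>f (r + 2) = s\<close>, so column \<open>s + 1\<close> ends by row
  \<open>r + 1\<close> and is too short for a vertical rim hook. If it reached row
  \<open>r + 1\<close> while \<open>s > 0\<close>, the box \<open>(r + 1, s)\<close> would violate
  the JM condition.\<close>

lemma empty_row:
  assumes "K = s"
  shows "q' = 0" "K' = r \<or> s = 0"
proof -
  interpret sw: jm_corner l g f s r K' K q' q by (rule swap)
  have f2: "f (r + 2) = s" using K(1) low_row assms by simp
  have g1: "g (s + 1) \<le> r + 1" using iff[of "r + 2" "s + 1"] f2 by auto
  have rK': "r \<le> K'" using sw.low_row K'(1) by linarith
  show q': "q' = 0"
  proof (rule ccontr)
    assume "q' \<noteq> 0"
    then have "l \<le> q' * l" by simp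
    then show False using gK g1 rK' l by linarith
  qed
  show "K' = r \<or> s = 0"
  proof (rule ccontr)
    assume neg: "\<not> (K' = r \<or> s = 0)"
    then have gs1: "g (s + 1) = r + 1" using gK q' g1 rK' by simp
    then have "s + 1 \<le> f (r + 1)" using iff[of "r + 1" "s + 1"] by simp
    then have "q \<noteq> 0" using fK assms by auto
    then have "l \<le> q * l" by simp
    then have fs: "s + 3 \<le> f (r + 1)" using fK assms l by linarith
    have gs2: "g (s + 2) = r + 1"
      using iff[of "r + 1" "s + 2"] fs conj_funs_antimono[OF conj_funs_sym[OF fg], of "s + 1" "s + 2"] gs1
      by simp
    have gs: "r + 2 \<le> g s" using iff[of "r + 2" s] f2 neg by simp
    \<comment> \<open>Columns \<open>s\<close> and \<open>s + 1\<close> are congruent, so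
      divisibility passes from the hook \<open>q * l\<close> at \<open>(r + 1, s + 1)\<close> to the
      box on its left.\<close>
    have "int l dvd int (Suc (g s - g (s + 1)))"
      using cdvd[of s] neg by (simp del: of_nat_Suc)
    then have "int l dvd int (g s) - int (g (s + 1)) + 1"
      using gs gs1 by (simp add: of_nat_diff add.commute)
    moreover have "hook f g (r + 1) (s + 1) = int q * int l"
      using assms fK gs1 by (simp add: hook_def)
    moreover have "hook f g (r + 1) s = hook f g (r + 1) (s + 1) + (int (g s) - int (g (s + 1)) + 1)"
      by (simp add: hook_def)
    ultimately have dvd: "int l dvd hook f g (r + 1) s" by (simp only: dvd_add dvd_triv_right)
    have "1 \<le> r + 1" "1 \<le> s" "s \<le> f (r + 1)" using fs neg by auto
    then consider "\<forall>y. 1 \<le> y \<and> y \<le> f (r + 1) \<longrightarrow> int l dvd hook f g (r + 1) y"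
      | "\<forall>x. 1 \<le> x \<and> x \<le> g s \<longrightarrow> int l dvd hook f g x s"
      using jm dvd unfolding jm_funs_def by blast
    then show False
    proof cases
      case 1
      then have "int l dvd hook f g (r + 1) (s + 1) - hook f g (r + 1) (s + 2)"
        using fs by (intro dvd_diff) auto
      moreover have "hook f g (r + 1) (s + 1) - hook f g (r + 1) (s + 2) =
          int (g (s + 1)) - int (g (s + 2)) + 1"
        by (simp add: hook_def)
      ultimately show False using not_dvd_col by (simp only:)
    next
      case 2
      then have "int l dvd hook f g (r + 1) s - hook f g (r + 2) s"
        using gs by (intro dvd_diff) auto
      moreover have "hook f g (r + 1) s - hook f g (r + 2) s = int (f (r + 1)) - int (f (r + 2)) + 1"
        by (simp add: hook_def)
      ultimately show False using sw.not_dvd_col by (simp only:)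
    qed
  qed
qed

section \<open>Matching the diagram with the shape\<close>

lemma f_antimono: "1 \<le> a \<Longrightarrow> a \<le> a' \<Longrightarrow> f a' \<le> f a"
  by (rule conj_funs_antimono[OF fg])

text \<open>The frame lines have the lengths prescribed by \<open>P\<close> and \<open>Q\<close>;
  every other box lies below row \<open>r + 1\<close> and right of column \<open>s + 1\<close>,
  where trimming changes nothing.\<close>

lemma shape_trim:
  assumes M: "1 \<le> K - s" "1 \<le> K' - r"
    and fP: "\<forall>i\<ge>1. i \<le> r + 1 \<longrightarrow> f i = K + stair l r i + P i * l"
    and gQ: "\<forall>j\<ge>1. j \<le> s + 1 \<longrightarrow> g j = K' + stair l s j + Q j * l"
    and ab: "1 \<le> a" "1 \<le> b"
  shows "b \<le> f a \<longleftrightarrow>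
    shape l (trim f r s (K - s) (K' - r)) (trim g s r (K' - r) (K - s)) r s P Q a b"
    (is "_ \<longleftrightarrow> shape l ?m ?n r s P Q a b")
proof -
  have 1: "s + ?m 1 = K" "r + ?n 1 = K'" using M by (auto simp: trim_def)
  have row: "a \<le> r + 1 \<and> b \<le> s + ?m 1 + stair l r a + P a * l \<longleftrightarrow> a \<le> r + 1 \<and> b \<le> f a"
    using fP ab(1) 1 by auto
  have col: "b \<le> s + 1 \<and> a \<le> r + ?n 1 + stair l s b + Q b * l \<longleftrightarrow> b \<le> s + 1 \<and> b \<le> f a"
    using gQ ab(2) iff[OF ab] 1 by auto
  have "b \<le> s + ?m (a - r) \<longleftrightarrow> b \<le> f a" if "r + 1 < a" "s + 1 < b"
  proof
    assume "b \<le> s + ?m (a - r)"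
    then show "b \<le> f a" using that by (auto simp: trim_def split: if_splits)
  next
    assume "b \<le> f a"
    then show "b \<le> s + ?m (a - r)" using that inner_box[of "b - s" "a - r"] by (simp add: trim_def)
  qed
  moreover have "b \<le> f a" if "r < a" "s < b" "b \<le> s + ?m (a - r)" "a \<le> r + 1 \<or> b \<le> s + 1"
  proof (cases "a \<le> r + 1")
    case True
    then have "a = r + 1" using that by linarith
    then show ?thesis using that(3) 1 fK by simp
  next
    case False
    then have b: "b = s + 1" using that by linarith
    then have "a - r \<le> ?n 1"
      using conj_funsD[OF trim_conj_funs[OF M], of "a - r" 1] that by simp
    then show ?thesis using 1 gK iff[OF ab] b by simp
  qed
  ultimately show ?thesis unfolding shape_def row col by fastforce
qed

lemma shape_empty:
  assumes "K = s"
    and fP: "\<forall>i\<ge>1. i \<le> r + 1 \<longrightarrow> f i = K + stair l r i + P i * l"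
    and gQ: "\<forall>j\<ge>1. j \<le> s + 1 \<longrightarrow> g j = K' + stair l s j + Q j * l"
    and Q0: "Q (s + 1) = q'"
    and ab: "1 \<le> a" "1 \<le> b"
  shows "b \<le> f a \<longleftrightarrow> shape l (\<lambda>_. 0) (\<lambda>_. 0) r s P Q a b"
proof -
  interpret sw: jm_corner l g f s r K' K q' q by (rule swap)
  have row: "b \<le> f a \<longleftrightarrow> b \<le> s + stair l r a + P a * l" if "a \<le> r + 1"
    using fP[rule_format, OF ab(1) that] assms(1) by simp
  have low: "b \<le> s" if "r + 1 < a" "b \<le> f a"
    using f_antimono[of "r + 2" a] K(1) assms(1) that by simp
  consider "K' = r" | "s = 0" "Q 1 = 0" using empty_row[OF assms(1)] Q0 by auto
  then show ?thesis
  proof cases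
    case 1
    then have "b \<le> s + 1 \<and> a \<le> r + stair l s b + Q b * l \<longleftrightarrow> b \<le> s + 1 \<and> b \<le> f a"
      using gQ ab(2) iff[OF ab] by auto
    then show ?thesis unfolding shape_def using row low by fastforce
  next
    case 2
    \<comment> \<open>\<open>K'\<close> may exceed \<open>r\<close> here: the box of column 1 in row
      \<open>r + 1\<close> then comes from the row part, so the column part may stop at row
      \<open>r\<close>.\<close>
    have "b \<le> s + 1 \<and> a \<le> r + stair l s b + Q b * l \<longleftrightarrow> b = 1 \<and> a \<le> r"
      using 2 ab by (cases "b = 1") auto
    moreover have "b \<le> f a" if "b = 1" "a \<le> r"
      using that iff[OF ab] sw.low_row K'(1) gK 2 by simp
    moreover have "\<not> b \<le> f a" if "r + 1 < a" using low[OF that] 2 ab by auto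
    moreover have "\<not> (s < b \<and> b \<le> s)" by simp
    ultimately show ?thesis unfolding shape_def add_0_right using row by (meson not_le)
  qed
qed

text \<open>If \<open>\<mu>\<close> came out as the single row \<open>(l - 1)\<close>, this row is attached as one more row
  to the empty core.\<close>

lemma shape_single_row:
  assumes "K' - r = 1" "K - s = l - 1"
    and fP: "\<forall>i\<ge>1. i \<le> r + 1 \<longrightarrow> f i = K + stair l r i + P i * l"
    and gQ: "\<forall>j\<ge>1. j \<le> s + 1 \<longrightarrow> g j = K' + stair l s j + Q j * l"
    and P0: "P (r + 2) = 0"
    and ab: "1 \<le> a" "1 \<le> b"
  shows "b \<le> f a \<longleftrightarrow> shape l (\<lambda>_. 0) (\<lambda>_. 0) (r + 1) s P Q a b"
proof -
  \<comment> \<open>Row \<open>r + 1\<close> is exactly one staircase step, up to its rim hooks,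
    above a base row of length \<open>s\<close>, and \<open>K' = r + 1\<close> fits an empty \<mu>
    below it.\<close>
  have K1: "K' = r + 1" "K = s + (l - 1)" using assms(1,2) l by linarith+
  have row: "b \<le> f a \<longleftrightarrow> b \<le> s + stair l (r + 1) a + P a * l" if "a \<le> r + 1"
    using fP[rule_format, OF ab(1) that] stair_SucSuc[of a r l] that K1 by (simp add: ac_simps)
  \<comment> \<open>In the larger frame, row \<open>r + 2\<close> contributes only its first
    \<open>s\<close> boxes, already present by \<open>low_row\<close>.\<close>
  have next_row: "b \<le> f a" if "a = r + 2" "b \<le> s + stair l (r + 1) a + P a * l"
    using that P0 low_row by simp
  have col: "b \<le> s + 1 \<and> a \<le> r + 1 + stair l s b + Q b * l \<longleftrightarrow> b \<le> s + 1 \<and> b \<le> f a"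
    using gQ ab(2) iff[OF ab] K1 by auto
  have "b \<le> s + 1" if "r + 1 < a" "b \<le> f a"
    using inner_box[of "b - s" "a - r"] that assms(1) by fastforce
  then have "b \<le> f a \<longleftrightarrow> a \<le> r + 2 \<and> b \<le> s + stair l (r + 1) a + P a * l \<or>
      b \<le> s + 1 \<and> a \<le> r + 1 + stair l s b + Q b * l"
    unfolding col using row next_row
    by (cases "a \<le> r + 1"; cases "a = r + 2") auto
  then show ?thesis by (auto simp: shape_def)
qed

end

section \<open>Assembling the data\<close>

text \<open>Admissibility for functions, with bounded support in place of list lengths, so that
  lists are formed only once, after all case distinctions.\<close>

definition admissible_funs ::
    "nat \<Rightarrow> (nat \<Rightarrow> nat) \<Rightarrow> (nat \<Rightarrow> nat) \<Rightarrow> nat \<Rightarrow> nat \<Rightarrow> (nat \<Rightarrow> nat) \<Rightarrow> (nat \<Rightarrow> nat) \<Rightarrow> bool" where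
  "admissible_funs l m n r s P Q \<longleftrightarrow> conj_funs m n \<and>
     (\<forall>a\<ge>1. \<forall>b\<ge>1. b \<le> m a \<longrightarrow> \<not> int l dvd hook m n a b) \<and>
     m 1 - m 2 < l - 1 \<and> n 1 - n 2 < l - 1 \<and>
     (\<forall>a\<ge>1. \<forall>a'\<ge>a. P a' \<le> P a) \<and> (\<forall>b\<ge>1. \<forall>b'\<ge>b. Q b' \<le> Q b) \<and>
     (\<forall>a>r + 1. P a = 0) \<and> (\<forall>b>s + 1. Q b = 0) \<and>
     (m 1 = 0 \<longrightarrow> P (r + 1) = 0 \<or> Q (s + 1) = 0)"

lemma (in jm_corner) ex_shape:
  "\<exists>m n r s P Q. admissible_funs l m n r s P Q \<and>
     (\<forall>a\<ge>1. \<forall>b\<ge>1. b \<le> f a \<longleftrightarrow> shape l m n r s P Q a b)"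
proof -
  interpret sw: jm_corner l g f s r K' K q' q by (rule swap)
  have l2: "2 \<le> l" using l by simp
  have f: "\<And>i. 1 \<le> i \<Longrightarrow> f (Suc i) \<le> f i" and g: "\<And>i. 1 \<le> i \<Longrightarrow> g (Suc i) \<le> g i"
    using f_antimono sw.f_antimono by simp_all
  have fK': "f (Suc r) = K + q * l" and gK': "g (Suc s) = K' + q' * l" using fK gK by simp_all
  obtain P where Pa: "\<forall>a\<ge>1. \<forall>a'\<ge>a. P a' \<le> P a" and P0: "\<And>a. r + 1 < a \<Longrightarrow> P a = 0"
    and Pq: "P (r + 1) = q"
    and fP: "\<forall>i\<ge>1. i \<le> r + 1 \<longrightarrow> f i = K + stair l r i + P i * l"
    using ladder[OF l2 f rdvd fK'] by blast
  obtain Q where Qa: "\<forall>a\<ge>1. \<forall>a'\<ge>a. Q a' \<le> Q a" and Q0: "\<And>a. s + 1 < a \<Longrightarrow> Q a = 0"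
    and Qq: "Q (s + 1) = q'"
    and gQ: "\<forall>j\<ge>1. j \<le> s + 1 \<longrightarrow> g j = K' + stair l s j + Q j * l"
    using ladder[OF l2 g cdvd gK'] by blast
  have P0': "P (r + 2) = 0" "Q (s + 2) = 0" using P0 Q0 by simp_all
  have zero: "conj_funs (\<lambda>_. 0) (\<lambda>_. 0)" by (simp add: conj_funs_def)
  have flip: "b \<le> f a \<longleftrightarrow> shape l m n r s P Q a b"
    if "conj_funs m n" "a \<le> g b \<longleftrightarrow> shape l n m s r Q P b a" "1 \<le> a" "1 \<le> b" for a b m n r s P Q
    using iff[OF that(3,4)] that(2) shape_swap[OF that(1)] by blast
  have le: "s \<le> K" "r \<le> K'" using low_row sw.low_row K K' by linarith+
  \<comment> \<open>\<mu> is taken empty if nothing remains in row \<open>r + 1\<close> or column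
    \<open>s + 1\<close>, and also if the remainder is a single row or column of length
    \<open>l - 1\<close>, which violates the gap condition and joins the frame instead.\<close>
  consider (row) "K = s" | (col) "K' = r"
    | (one_row) "K' - r = 1" "K - s = l - 1" | (one_col) "K - s = 1" "K' - r = l - 1"
    | (trim) "1 \<le> K - s" "1 \<le> K' - r" "\<not> (K' - r = 1 \<and> K - s = l - 1)"
        "\<not> (K - s = 1 \<and> K' - r = l - 1)"
    using le by linarith
  then show ?thesis
  proof cases
    case row
    then have "admissible_funs l (\<lambda>_. 0) (\<lambda>_. 0) r s P Q"
      using zero Pa Qa P0 Q0 Qq empty_row l by (simp add: admissible_funs_def)
    then show ?thesis using shape_empty[OF row fP gQ Qq] by blast
  next
    case col
    then have "admissible_funs l (\<lambda>_. 0) (\<lambda>_. 0) r s P Q"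
      using zero Pa Qa P0 Q0 Pq sw.empty_row l by (simp add: admissible_funs_def)
    then show ?thesis using flip[OF zero sw.shape_empty[OF col gQ fP Pq]] by blast
  next
    case one_row
    have "admissible_funs l (\<lambda>_. 0) (\<lambda>_. 0) (r + 1) s P Q"
      using zero Pa Qa P0 Q0 l by (simp add: admissible_funs_def)
    then show ?thesis using shape_single_row[OF one_row fP gQ P0'(1)] by blast
  next
    case one_col
    have "admissible_funs l (\<lambda>_. 0) (\<lambda>_. 0) r (s + 1) P Q"
      using zero Pa Qa P0 Q0 l by (simp add: admissible_funs_def)
    then show ?thesis using flip[OF zero sw.shape_single_row[OF one_col gQ fP P0'(2)]] by blast
  next
    case trim
    let ?m = "trim f r s (K - s) (K' - r)" and ?n = "trim g s r (K' - r) (K - s)"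
    have "?m 1 \<noteq> 0" using trim(1) by (simp add: trim_def)
    then have "admissible_funs l ?m ?n r s P Q"
      unfolding admissible_funs_def
      using trim_conj_funs[OF trim(1,2)] trim_core[OF trim(1,2)] trim_diff[OF trim(1,2)]
        sw.trim_diff[OF trim(2,1)] trim(3,4) Pa Qa P0 Q0 by blast
    then show ?thesis using shape_trim[OF trim(1,2) fP gQ] by blast
  qed
qed

lemma jm_ex_shape:
  assumes l: "3 \<le> l" and fg: "conj_funs f g" and jm: "jm_funs l f g"
  shows "\<exists>m n r s P Q. admissible_funs l m n r s P Q \<and>
    (\<forall>a\<ge>1. \<forall>b\<ge>1. b \<le> f a \<longleftrightarrow> shape l m n r s P Q a b)"
proof -
  have l2: "2 \<le> l" using l by simp
  \<comment> \<open>\<open>K\<close> is \<open>y\<close> plus the remainder of \<open>x - y\<close>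
    modulo \<open>l\<close>; non-divisibility excludes the remainder \<open>l - 1\<close>.\<close>
  have split: "\<exists>K q. x = K + q * l \<and> y \<le> K \<and> K < y + (l - 1)"
    if "y \<le> x" "\<not> l dvd Suc (x - y)" for x y
  proof (intro exI conjI)
    let ?d = "(x - y) mod l"
    have "x - y = (x - y) div l * l + ?d" by simp
    then show "x = (y + ?d) + (x - y) div l * l" using that(1) by linarith
    have "Suc ?d \<noteq> l"
    proof
      assume "Suc ?d = l"
      then have "Suc (x - y) mod l = 0" by (simp add: mod_Suc)
      then show False using that(2) by (simp add: dvd_eq_mod_eq_0)
    qed
    moreover have "?d < l" using l by simp
    ultimately show "y + ?d < y + (l - 1)" by linarith
  qed simp
  have f: "f (r + 2) \<le> f (r + 1)" and g: "g (r + 2) \<le> g (r + 1)" for r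
    using conj_funs_antimono[OF fg] conj_funs_antimono[OF conj_funs_sym[OF fg]] by simp_all
  obtain r where r: "\<And>i. 1 \<le> i \<Longrightarrow> i \<le> r \<Longrightarrow> l dvd Suc (f i - f (Suc i))"
    "\<not> l dvd Suc (f (r + 1) - f (r + 2))"
    using maximal_ladder[OF fg l2] by auto
  obtain s where s: "\<And>i. 1 \<le> i \<Longrightarrow> i \<le> s \<Longrightarrow> l dvd Suc (g i - g (Suc i))"
    "\<not> l dvd Suc (g (s + 1) - g (s + 2))"
    using maximal_ladder[OF conj_funs_sym[OF fg] l2] by auto
  obtain K q where "f (r + 1) = K + q * l" "f (r + 2) \<le> K" "K < f (r + 2) + (l - 1)"
    using split[OF f r(2)] by blast
  moreover obtain K' q' where "g (s + 1) = K' + q' * l" "g (s + 2) \<le> K'" "K' < g (s + 2) + (l - 1)"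
    using split[OF g s(2)] by blast
  ultimately interpret jm_corner l f g r s K K' q q'
    using l fg jm r(1) s(1) by (simp add: jm_corner_def)
  show ?thesis by (rule ex_shape)
qed

text \<open>The functions found are weakly decreasing with bounded support, so they are part
  functions of lists; hooks and column lengths carry over since only positive indices
  matter.\<close>

lemma jm_has_form:
  assumes l: "3 \<le> l" and jm: "is_JM l p"
  shows "\<exists>\<mu> r s \<rho> \<sigma>. admissible l \<mu> r s \<rho> \<sigma> \<and> has_form l p \<mu> r s \<rho> \<sigma>"
proof -
  have p: "is_partition p" using jm by (simp add: is_JM_def)
  note fg = conj_funs_part[OF p]
  have "jm_funs l (part p) (col_len (diagram p))" using is_JM_iff[OF p fg] jm by blast
  then obtain m n r s P Q where adm: "admissible_funs l m n r s P Q"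
    and sh: "\<forall>a\<ge>1. \<forall>b\<ge>1. b \<le> part p a \<longleftrightarrow> shape l m n r s P Q a b"
    using jm_ex_shape[OF l fg] by blast
  have mn: "conj_funs m n" using adm by (simp add: admissible_funs_def)
  have "m a = 0" if "n 1 < a" for a using conj_funsD[OF mn, of a 1] that by auto
  then obtain \<mu> where \<mu>: "is_partition \<mu>" and \<mu>m: "\<And>a. 1 \<le> a \<Longrightarrow> part \<mu> a = m a"
    using partition_of_fun[of m "n 1"] conj_funs_antimono[OF mn] by metis
  have Pa: "P a' \<le> P a" "Q a' \<le> Q a" if "1 \<le> a" "a \<le> a'" for a a'
    using adm that unfolding admissible_funs_def by blast+
  have P0: "r + 1 < a \<Longrightarrow> P a = 0" "s + 1 < a \<Longrightarrow> Q a = 0" for a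
    using adm unfolding admissible_funs_def by blast+
  obtain \<rho> where \<rho>: "is_partition \<rho>" "length \<rho> \<le> r + 1" "\<And>a. 1 \<le> a \<Longrightarrow> part \<rho> a = P a"
    using partition_of_fun[of P "r + 1"] Pa(1) P0(1) by metis
  obtain \<sigma> where \<sigma>: "is_partition \<sigma>" "length \<sigma> \<le> s + 1" "\<And>a. 1 \<le> a \<Longrightarrow> part \<sigma> a = Q a"
    using partition_of_fun[of Q "s + 1"] Pa(2) P0(2) by metis
  note mn' = conj_funs_part[OF \<mu>]
  have \<mu>n: "col_len (diagram \<mu>) b = n b" if "1 \<le> b" for b
    using conj_funs_unique[OF mn' mn \<mu>m that] .
  have hook: "hook (part \<mu>) (col_len (diagram \<mu>)) a b = hook m n a b" if "1 \<le> a" "1 \<le> b" for a b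
    using \<mu>m \<mu>n that by (simp add: hook_def)
  have "is_core l \<mu>"
    using adm is_core_iff[OF \<mu> mn'] hook \<mu>m by (simp add: admissible_funs_def)
  moreover have "part (conjugate \<mu>) b = n b" if "1 \<le> b" for b
    using part_conjugate[OF \<mu> that] \<mu>n[OF that] by simp
  moreover have "\<mu> = [] \<longleftrightarrow> m 1 = 0" using part_eq_0_iff[OF \<mu>] \<mu>m by simp
  ultimately have "admissible l \<mu> r s \<rho> \<sigma>"
    using adm \<mu>m \<rho> \<sigma> by (simp add: admissible_def admissible_funs_def)
  moreover have "shape l (part \<mu>) (col_len (diagram \<mu>)) r s (part \<rho>) (part \<sigma>) a b \<longleftrightarrow>
      shape l m n r s P Q a b" if "1 \<le> a" "1 \<le> b" for a b
    using \<mu>m \<mu>n \<rho>(3)[OF that(1)] \<sigma>(3)[OF that(2)] by (rule shape_cong)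
  then have "has_form l p \<mu> r s \<rho> \<sigma>"
    using has_form_iff[OF p \<mu>, of l r s \<rho> \<sigma>] l sh by simp
  ultimately show ?thesis by blast
qed

theorem theorem3p2:
  fixes l :: nat
  assumes "l \<ge> 3"
  shows "(\<forall>\<mu> r s \<rho> \<sigma>. admissible l \<mu> r s \<rho> \<sigma> \<longrightarrow>
            (\<exists>!p. has_form l p \<mu> r s \<rho> \<sigma>) \<and>
            (\<forall>p. has_form l p \<mu> r s \<rho> \<sigma> \<longrightarrow> is_JM l p))
       \<and> (\<forall>p. is_JM l p \<longrightarrow>
            (\<exists>\<mu> r s \<rho> \<sigma>. admissible l \<mu> r s \<rho> \<sigma> \<and> has_form l p \<mu> r s \<rho> \<sigma>))"
proof -
  have "2 \<le> l" using assms by simp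
  then show ?thesis using admissible_ex1_jm jm_has_form[OF assms] by blast
qed

end
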